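(* Let $M$ be a smooth finite-dimensional manifold and let $\mathcal G=(\psi,U)$ be any gauge on $M$. Let $\mathbf y=(y,y^\dagger)$ be a pair of continuous functions $y:[0,T]\to M$, $y^\dagger:[0,T]\to L(W,TM)$ with $y_s^\dagger\in L(W,T_{y_s}M)$ for all $s\in[0,T]$. Then $\mathbf y$ is a chart-rough path controlled by $\mathbf X$ if and only if $\mathbf y$ is a $(\psi,U)$-rough path controlled by $\mathbf X$.
   Context: Rough paths. $W=\mathbb R^k$, $T>0$, $1\le p<3$, $\Delta_{[0,T]}=\{(s,t):0\le s\le t\le T\}$. A control is a continuous $\omega:\Delta_{[0,T]}\to[0,\infty)$ with $\omega(s,s)=0$ and $\omega(s,t)+\omega(t,u)\le\omega(s,u)$ for $s\le t\le u$. $\mathbf X=(x,\mathbb X)$ is a fixed weak-geometric $p$-rough path with control $\omega$: $x:[0,T]\to W$ and $\mathbb X:\Delta_{[0,T]}\to W\otimes W$ are continuous and, with $x_{s,t}:=x_t-x_s$, one has $\mathbb X_{s,u}=\mathbb X_{s,t}+\mathbb X_{t,u}+x_{s,t}\otimes x_{t,u}$ for $s\le t\le u$, $|x_{s,t}|\le\omega(s,t)^{1/p}$, $|\mathbb X_{s,t}|\le\omega(s,t)^{2/p}$, and the symmetric part of $\mathbb X_{s,t}$ equals $\frac12x_{s,t}\otimes x_{s,t}$. Gauges. A diagonal domain is an open $\mathcal D\subseteq M\times M$ containing $\{(m,m):m\in M\}$. A logarithm is a smooth $\psi:\mathcal D\to TM$ with $\psi(m,n)\in T_mM$, $\psi(m,m)=0_m$,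 and differential of $n\mapsto\psi(m,n)$ at $n=m$ equal to the identity of $T_mM$. A parallelism is a smooth map $(n,m)\in\mathcal D\mapsto U(n,m)\in L(T_mM,T_nM)$ with $U(m,m)=I$. A gauge is a pair $(\psi,U)$ of a logarithm and a parallelism with a common diagonal domain $\mathcal D$. $(\psi,U)$-rough path controlled by $\mathbf X$: fix any Riemannian metric $g$ on $M$; there exist $C>0$ and $\delta>0$ ($\delta$ small enough that all expressions are defined) such that for all $0\le s\le t\le T$ with $t-s\le\delta$: $|\psi(y_s,y_t)-y_s^\dagger x_{s,t}|_g\le C\omega(s,t)^{2/p}$ and $|U(y_s,y_t)y_t^\dagger-y_s^\dagger|_g\le C\omega(s,t)^{1/p}$. Chart-rough path controlled by $\mathbf X$: for every chart $\phi$ of $M$ with domain $D(\phi)$ and every $[a,b]\subseteq[0,T]$ with $y([a,b])\subseteq D(\phi)$ there is $C_{\phi,a,b}\ge0$ such that for all $a\le s\le t\le b$: $|\phi(y_t)-\phi(y_s)-d\phi\circ y_s^\dagger x_{s,t}|\le C_{\phi,a,b}\,\omega(s,t)^{2/p}$ and $|d\phi\circ y_t^\dagger-d\phi\circ y_s^\dagger|\le C_{\phi,a,b}\,\omega(s,t)^{1/p}$. (Here $d\phi$ is the $\mathbb R^d$-valued differential, with base points dropped.) *)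

theory Defs
  imports "HOL-Analysis.Analysis" "HOL-Library.Function_Algebras"
begin

section \<open>Finite-dimensional model spaces\<close>

text \<open>The class \<open>euclidean_space\<close> forces positive dimension.  Manifolds are modelled on types of
  the following class, which also covers dimension zero.\<close>

class fin_dim_inner = real_inner +
  assumes ex_finite_spanning: "\<exists>B. finite B \<and> (\<forall>x. \<exists>u. x = (\<Sum>b\<in>B. u b *\<^sub>R b))"

subclass (in euclidean_space) fin_dim_inner
proof
  show "\<exists>B::'a set. finite B \<and> (\<forall>x. \<exists>u. x = (\<Sum>b\<in>B. u b *\<^sub>R b))"
    by (metis finite_Basis euclidean_representation)
qed

instantiation unit :: real_inner
begin

definition "plus (_::unit) (_::unit) = ()"
definition "zero_unit = ()"
definition "scaleR (_::real) (_::unit) = ()"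
definition "inner (_::unit) (_::unit) = (0::real)"
definition "norm (_::unit) = (0::real)"
definition "dist (_::unit) (_::unit) = (0::real)"
definition "sgn (_::unit) = ()"
definition "uniformity_unit =
  (INF e\<in>{0<..}. principal {(x::unit, y). dist x y < e})"
definition "open_unit (_::unit set) = True"

instance
proof
  fix S :: "unit set"
  show "open S \<longleftrightarrow> (\<forall>x\<in>S. \<forall>\<^sub>F (x', y) in uniformity. x' = x \<longrightarrow> y \<in> S)"
    by (auto simp: open_unit_def case_prod_beta intro!: always_eventually)
qed (simp_all add: uniformity_unit_def inner_unit_def norm_unit_def dist_unit_def)

end

instance unit :: fin_dim_inner
proof
  show "\<exists>B::unit set. finite B \<and> (\<forall>x. \<exists>u. x = (\<Sum>b\<in>B. u b *\<^sub>R b))"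
    by (intro exI[of _ UNIV]) simp
qed

section \<open>Smooth maps between open subsets of vector spaces\<close>

text \<open>On an open subset of a finite-dimensional space, \<open>f\<close> is of class \<open>C\<^sup>n\<close> iff all iterated
  directional derivatives up to order \<open>n\<close> exist as Frechet derivatives and are continuous.
  Only used for open sets \<open>S\<close>.\<close>

primrec Ck_on ::
  "nat \<Rightarrow> 'a::real_normed_vector set \<Rightarrow> ('a \<Rightarrow> 'b::real_normed_vector) \<Rightarrow> bool" where
  "Ck_on 0 S f = continuous_on S f"
| "Ck_on (Suc n) S f =
    ((\<forall>z\<in>S. f differentiable (at z)) \<and> (\<forall>v. Ck_on n S (\<lambda>z. frechet_derivative f (at z) v)))"

definition smooth_on ::
  "'a::real_normed_vector set \<Rightarrow> ('a \<Rightarrow> 'b::real_normed_vector) \<Rightarrow> bool" where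
  "smooth_on S f \<longleftrightarrow> (\<forall>n. Ck_on n S f)"

section \<open>Smooth manifolds\<close>

text \<open>A chart is a pair of its domain and its coordinate map; the values of the map outside the
  domain are irrelevant.\<close>

type_synonym ('m, 'e) chart = "'m set \<times> ('m \<Rightarrow> 'e)"

abbreviation cdom :: "('m, 'e) chart \<Rightarrow> 'm set" where "cdom \<equiv> fst"
abbreviation cmap :: "('m, 'e) chart \<Rightarrow> 'm \<Rightarrow> 'e" where "cmap \<equiv> snd"

definition cinv :: "('m, 'e) chart \<Rightarrow> 'e \<Rightarrow> 'm" where
  "cinv c = inv_into (cdom c) (cmap c)"

definition topological_chart ::
  "('m::topological_space, 'e::real_normed_vector) chart \<Rightarrow> bool" where
  "topological_chart c \<longleftrightarrow> open (cdom c) \<and> open (cmap c ` cdom c) \<and>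
     homeomorphism (cdom c) (cmap c ` cdom c) (cmap c) (cinv c)"

definition smooth_transition ::
  "('m, 'e::real_normed_vector) chart \<Rightarrow> ('m, 'e) chart \<Rightarrow> bool" where
  "smooth_transition c c' \<longleftrightarrow> smooth_on (cmap c ` (cdom c \<inter> cdom c')) (cmap c' \<circ> cinv c)"

text \<open>A smooth structure is a maximal smooth atlas, i.e. the set of all charts of the manifold.\<close>

definition smooth_structure ::
  "('m::topological_space, 'e::real_normed_vector) chart set \<Rightarrow> bool" where
  "smooth_structure A \<longleftrightarrow>
     (\<forall>c\<in>A. topological_chart c) \<and> (\<Union>c\<in>A. cdom c) = UNIV \<and>
     (\<forall>c\<in>A. \<forall>c'\<in>A. smooth_transition c c') \<and>
     (\<forall>c. topological_chart c \<and> (\<forall>c'\<in>A. smooth_transition c c' \<and> smooth_transition c' c)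
        \<longrightarrow> c \<in> A)"

text \<open>Maps between spaces described by families of charts \<open>A\<close>, \<open>B\<close> (these need not be maximal,
  and for \<open>B\<close> no topology on the ambient type is used: the target carries the smooth
  structure, hence the topology, induced by \<open>B\<close>).  Openness of the sets on which the local
  representatives live is continuity of \<open>f\<close>.\<close>

definition smooth_map_on :: "('a, 'e::real_normed_vector) chart set \<Rightarrow>
    ('b, 'f::real_normed_vector) chart set \<Rightarrow> 'a set \<Rightarrow> ('a \<Rightarrow> 'b) \<Rightarrow> bool" where
  "smooth_map_on A B S f \<longleftrightarrow>
     (\<forall>p\<in>S. \<exists>c'\<in>B. f p \<in> cdom c') \<and>
     (\<forall>c\<in>A. \<forall>c'\<in>B. let V = cmap c ` {p \<in> cdom c \<inter> S. f p \<in> cdom c'}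
        in open V \<and> smooth_on V (cmap c' \<circ> f \<circ> cinv c))"

definition continuous_map_into :: "('b, 'f::real_normed_vector) chart set \<Rightarrow>
    'a::topological_space set \<Rightarrow> ('a \<Rightarrow> 'b) \<Rightarrow> bool" where
  "continuous_map_into B S f \<longleftrightarrow>
     (\<forall>p\<in>S. \<exists>c\<in>B. f p \<in> cdom c) \<and>
     (\<forall>c\<in>B. openin (top_of_set S) {p \<in> S. f p \<in> cdom c} \<and>
        continuous_on {p \<in> S. f p \<in> cdom c} (cmap c \<circ> f))"

definition product_atlas :: "('m, 'e) chart set \<Rightarrow> ('m \<times> 'm, 'e \<times> 'e) chart set" where
  "product_atlas A = (\<lambda>(c, c'). (cdom c \<times> cdom c', map_prod (cmap c) (cmap c'))) ` (A \<times> A)"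

section \<open>Tangent vectors\<close>

text \<open>A tangent vector at \<open>m\<close> is represented by its coordinates in all charts around \<open>m\<close>, related
  by the derivatives of the chart transitions (and \<open>0\<close> elsewhere, so that tangent vectors are
  determined by their coordinates).  The vector space structure is the pointwise one.\<close>

type_synonym ('m, 'e) tvec = "('m, 'e) chart \<Rightarrow> 'e"

instantiation "fun" :: (type, real_vector) real_vector
begin

definition scaleR_fun :: "real \<Rightarrow> ('a \<Rightarrow> 'b) \<Rightarrow> 'a \<Rightarrow> 'b" where
  "scaleR_fun r f = (\<lambda>x. r *\<^sub>R f x)"

instance
  by standard (simp_all add: scaleR_fun_def fun_eq_iff scaleR_add_right scaleR_add_left)

end

definition transition_deriv :: "('m, 'e::real_normed_vector) chart \<Rightarrow> ('m, 'e) chart \<Rightarrow>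
    'm \<Rightarrow> 'e \<Rightarrow> 'e" where
  "transition_deriv c c' m = frechet_derivative (cmap c' \<circ> cinv c) (at (cmap c m))"

definition tangent_space ::
  "('m, 'e::real_normed_vector) chart set \<Rightarrow> 'm \<Rightarrow> ('m, 'e) tvec set" where
  "tangent_space A m = {v.
     (\<forall>c\<in>A. \<forall>c'\<in>A. m \<in> cdom c \<inter> cdom c' \<longrightarrow> v c' = transition_deriv c c' m (v c)) \<and>
     (\<forall>c. \<not> (c \<in> A \<and> m \<in> cdom c) \<longrightarrow> v c = 0)}"

text \<open>The differential \<open>d\<phi>\<close> of a chart, base points dropped.\<close>

definition chart_differential :: "('m, 'e) chart \<Rightarrow> ('m, 'e) tvec \<Rightarrow> 'e" where
  "chart_differential c v = v c"

definition coordinate_vector :: "('m, 'e::real_normed_vector) chart set \<Rightarrow> ('m, 'e) chart \<Rightarrow>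
    'm \<Rightarrow> 'e \<Rightarrow> ('m, 'e) tvec" where
  "coordinate_vector A c m a =
     (\<lambda>c'. if c' \<in> A \<and> m \<in> cdom c' then transition_deriv c c' m a else 0)"

definition tangent_atlas :: "('m, 'e::real_normed_vector) chart set \<Rightarrow>
    ('m \<times> ('m, 'e) tvec, 'e \<times> 'e) chart set" where
  "tangent_atlas A = (\<lambda>c. ({(m, v). m \<in> cdom c \<and> v \<in> tangent_space A m},
      \<lambda>(m, v). (cmap c m, chart_differential c v))) ` A"

text \<open>\<open>L(T\<^sub>mM, T\<^sub>nM)\<close>; values outside \<open>T\<^sub>mM\<close> are irrelevant.\<close>

definition tangent_linear_maps :: "('m, 'e::real_normed_vector) chart set \<Rightarrow> 'm \<Rightarrow> 'm \<Rightarrow>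
    (('m, 'e) tvec \<Rightarrow> ('m, 'e) tvec) set" where
  "tangent_linear_maps A m n = {F. F ` tangent_space A m \<subseteq> tangent_space A n \<and>
     (\<forall>u\<in>tangent_space A m. \<forall>v\<in>tangent_space A m. F (u + v) = F u + F v) \<and>
     (\<forall>r. \<forall>u\<in>tangent_space A m. F (r *\<^sub>R u) = r *\<^sub>R F u)}"

text \<open>Charts of the bundle over \<open>M \<times> M\<close> with fibre \<open>L(T\<^sub>mM, T\<^sub>nM)\<close> at \<open>(n, m)\<close>.\<close>

definition tangent_hom_atlas :: "('m, 'e::real_normed_vector) chart set \<Rightarrow>
    (('m \<times> 'm) \<times> (('m, 'e) tvec \<Rightarrow> ('m, 'e) tvec), ('e \<times> 'e) \<times> ('e \<Rightarrow>\<^sub>L 'e)) chart set" where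
  "tangent_hom_atlas A = (\<lambda>(c', c).
     ({((n, m), F). n \<in> cdom c' \<and> m \<in> cdom c \<and> F \<in> tangent_linear_maps A m n},
      \<lambda>((n, m), F). ((cmap c' n, cmap c m),
        Blinfun (\<lambda>a. chart_differential c' (F (coordinate_vector A c m a)))))) ` (A \<times> A)"

text \<open>\<open>L(W, T\<^sub>mM)\<close> and the bundle \<open>L(W, TM)\<close> over \<open>M\<close>.\<close>

definition linear_maps_into :: "('m, 'e::real_normed_vector) chart set \<Rightarrow> 'm \<Rightarrow>
    ('w::real_normed_vector \<Rightarrow> ('m, 'e) tvec) set" where
  "linear_maps_into A m = {L. linear L \<and> range L \<subseteq> tangent_space A m}"

definition linear_maps_atlas :: "('m, 'e::real_normed_vector) chart set \<Rightarrow>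
    ('m \<times> ('w::real_normed_vector \<Rightarrow> ('m, 'e) tvec), 'e \<times> ('w \<Rightarrow>\<^sub>L 'e)) chart set" where
  "linear_maps_atlas A = (\<lambda>c. ({(m, L). m \<in> cdom c \<and> L \<in> linear_maps_into A m},
      \<lambda>(m, L). (cmap c m, Blinfun (chart_differential c \<circ> L)))) ` A"

text \<open>Differential at \<open>n\<close> of a map \<open>h\<close> from a neighbourhood of \<open>n\<close> into a fixed vector space
  \<open>T\<^sub>mM\<close> (tangent spaces of which are identified with itself), computed in the chart \<open>c\<close>
  around \<open>n\<close>.  Since the linear structure of \<open>T\<^sub>mM\<close> is pointwise, so is differentiation.\<close>

definition differential_in_chart :: "('m, 'e::real_normed_vector) chart \<Rightarrow>
    ('m \<Rightarrow> ('m, 'e) tvec) \<Rightarrow> 'm \<Rightarrow> ('m, 'e) tvec \<Rightarrow> ('m, 'e) tvec" where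
  "differential_in_chart c h n v =
     (\<lambda>c'. frechet_derivative (\<lambda>z. h (cinv c z) c') (at (cmap c n)) (chart_differential c v))"

section \<open>Gauges\<close>

definition diagonal_domain :: "('m::topological_space \<times> 'm) set \<Rightarrow> bool" where
  "diagonal_domain D \<longleftrightarrow> open D \<and> (\<forall>m. (m, m) \<in> D)"

definition is_logarithm :: "('m::topological_space, 'e::real_normed_vector) chart set \<Rightarrow>
    ('m \<times> 'm) set \<Rightarrow> ('m \<Rightarrow> 'm \<Rightarrow> ('m, 'e) tvec) \<Rightarrow> bool" where
  "is_logarithm A D \<psi> \<longleftrightarrow>
     (\<forall>(m, n)\<in>D. \<psi> m n \<in> tangent_space A m) \<and>
     smooth_map_on (product_atlas A) (tangent_atlas A) D (\<lambda>(m, n). (m, \<psi> m n)) \<and>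
     (\<forall>m. \<psi> m m = 0) \<and>
     (\<forall>m. \<forall>c\<in>A. m \<in> cdom c \<longrightarrow>
        (\<forall>v\<in>tangent_space A m. differential_in_chart c (\<psi> m) m v = v))"

definition is_parallelism :: "('m::topological_space, 'e::real_normed_vector) chart set \<Rightarrow>
    ('m \<times> 'm) set \<Rightarrow> ('m \<Rightarrow> 'm \<Rightarrow> ('m, 'e) tvec \<Rightarrow> ('m, 'e) tvec) \<Rightarrow> bool" where
  "is_parallelism A D U \<longleftrightarrow>
     (\<forall>(n, m)\<in>D. U n m \<in> tangent_linear_maps A m n) \<and>
     smooth_map_on (product_atlas A) (tangent_hom_atlas A) D (\<lambda>(n, m). ((n, m), U n m)) \<and>
     (\<forall>m. \<forall>v\<in>tangent_space A m. U m m v = v)"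

definition is_gauge :: "('m::topological_space, 'e::real_normed_vector) chart set \<Rightarrow>
    ('m \<times> 'm) set \<Rightarrow> ('m \<Rightarrow> 'm \<Rightarrow> ('m, 'e) tvec) \<Rightarrow>
    ('m \<Rightarrow> 'm \<Rightarrow> ('m, 'e) tvec \<Rightarrow> ('m, 'e) tvec) \<Rightarrow> bool" where
  "is_gauge A D \<psi> U \<longleftrightarrow> diagonal_domain D \<and> is_logarithm A D \<psi> \<and> is_parallelism A D U"

section \<open>Riemannian metrics\<close>

definition riemannian_metric :: "('m, 'e::real_normed_vector) chart set \<Rightarrow>
    ('m \<Rightarrow> ('m, 'e) tvec \<Rightarrow> ('m, 'e) tvec \<Rightarrow> real) \<Rightarrow> bool" where
  "riemannian_metric A g \<longleftrightarrow>
     (\<forall>m. \<forall>u\<in>tangent_space A m. \<forall>v\<in>tangent_space A m.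
        g m u v = g m v u \<and>
        (\<forall>r. g m (r *\<^sub>R u) v = r * g m u v) \<and>
        (\<forall>w\<in>tangent_space A m. g m (u + w) v = g m u v + g m w v) \<and>
        (u \<noteq> 0 \<longrightarrow> g m u u > 0)) \<and>
     (\<forall>c\<in>A. \<forall>a b. smooth_on (cmap c ` cdom c)
        (\<lambda>z. g (cinv c z) (coordinate_vector A c (cinv c z) a)
                          (coordinate_vector A c (cinv c z) b)))"

definition metric_norm ::
  "('m \<Rightarrow> ('m, 'e) tvec \<Rightarrow> ('m, 'e) tvec \<Rightarrow> real) \<Rightarrow> 'm \<Rightarrow> ('m, 'e) tvec \<Rightarrow> real" where
  "metric_norm g m v = sqrt (g m v v)"

text \<open>Operator norm on \<open>L(W, T\<^sub>mM)\<close>.\<close>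

definition metric_onorm :: "('m \<Rightarrow> ('m, 'e) tvec \<Rightarrow> ('m, 'e) tvec \<Rightarrow> real) \<Rightarrow> 'm \<Rightarrow>
    ('w::real_normed_vector \<Rightarrow> ('m, 'e) tvec) \<Rightarrow> real" where
  "metric_onorm g m L = (SUP w\<in>cball 0 1. metric_norm g m (L w))"

section \<open>Rough paths\<close>

definition simplex2 :: "real \<Rightarrow> (real \<times> real) set" where
  "simplex2 T = {(s, t). 0 \<le> s \<and> s \<le> t \<and> t \<le> T}"

definition is_control :: "real \<Rightarrow> (real \<Rightarrow> real \<Rightarrow> real) \<Rightarrow> bool" where
  "is_control T \<omega> \<longleftrightarrow>
     continuous_on (simplex2 T) (\<lambda>(s, t). \<omega> s t) \<and>
     (\<forall>(s, t)\<in>simplex2 T. 0 \<le> \<omega> s t) \<and>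
     (\<forall>s\<in>{0..T}. \<omega> s s = 0) \<and>
     (\<forall>s t u. 0 \<le> s \<and> s \<le> t \<and> t \<le> u \<and> u \<le> T \<longrightarrow> \<omega> s t + \<omega> t u \<le> \<omega> s u)"

definition tensor :: "real^'k \<Rightarrow> real^'k \<Rightarrow> real^'k^'k" where
  "tensor a b = (\<chi> i j. a $ i * b $ j)"

definition weak_geometric_rough_path :: "real \<Rightarrow> real \<Rightarrow> (real \<Rightarrow> real \<Rightarrow> real) \<Rightarrow>
    (real \<Rightarrow> real^'k) \<Rightarrow> (real \<Rightarrow> real \<Rightarrow> real^'k^'k) \<Rightarrow> bool" where
  "weak_geometric_rough_path T p \<omega> x XX \<longleftrightarrow>
     is_control T \<omega> \<and> continuous_on {0..T} x \<and>
     continuous_on (simplex2 T) (\<lambda>(s, t). XX s t) \<and>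
     (\<forall>s t u. 0 \<le> s \<and> s \<le> t \<and> t \<le> u \<and> u \<le> T \<longrightarrow>
        XX s u = XX s t + XX t u + tensor (x t - x s) (x u - x t)) \<and>
     (\<forall>(s, t)\<in>simplex2 T.
        norm (x t - x s) \<le> \<omega> s t powr (1 / p) \<and>
        norm (XX s t) \<le> \<omega> s t powr (2 / p) \<and>
        (1 / 2) *\<^sub>R (XX s t + transpose (XX s t)) = (1 / 2) *\<^sub>R tensor (x t - x s) (x t - x s))"

definition chart_rough_path :: "('m, 'e::real_normed_vector) chart set \<Rightarrow> real \<Rightarrow> real \<Rightarrow>
    (real \<Rightarrow> real \<Rightarrow> real) \<Rightarrow> (real \<Rightarrow> 'w::real_normed_vector) \<Rightarrow>
    (real \<Rightarrow> 'm) \<Rightarrow> (real \<Rightarrow> 'w \<Rightarrow> ('m, 'e) tvec) \<Rightarrow> bool" where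
  "chart_rough_path A T p \<omega> x y y' \<longleftrightarrow>
     (\<forall>c\<in>A. \<forall>a b. 0 \<le> a \<and> a \<le> b \<and> b \<le> T \<and> y ` {a..b} \<subseteq> cdom c \<longrightarrow>
        (\<exists>C\<ge>0. \<forall>s t. a \<le> s \<and> s \<le> t \<and> t \<le> b \<longrightarrow>
           norm (cmap c (y t) - cmap c (y s) - chart_differential c (y' s (x t - x s)))
             \<le> C * \<omega> s t powr (2 / p) \<and>
           onorm (\<lambda>w. chart_differential c (y' t w) - chart_differential c (y' s w))
             \<le> C * \<omega> s t powr (1 / p)))"

definition gauge_rough_path :: "('m \<times> 'm) set \<Rightarrow> ('m \<Rightarrow> 'm \<Rightarrow> ('m, 'e::real_normed_vector) tvec) \<Rightarrow>
    ('m \<Rightarrow> 'm \<Rightarrow> ('m, 'e) tvec \<Rightarrow> ('m, 'e) tvec) \<Rightarrow>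
    ('m \<Rightarrow> ('m, 'e) tvec \<Rightarrow> ('m, 'e) tvec \<Rightarrow> real) \<Rightarrow> real \<Rightarrow> real \<Rightarrow>
    (real \<Rightarrow> real \<Rightarrow> real) \<Rightarrow> (real \<Rightarrow> 'w::real_normed_vector) \<Rightarrow>
    (real \<Rightarrow> 'm) \<Rightarrow> (real \<Rightarrow> 'w \<Rightarrow> ('m, 'e) tvec) \<Rightarrow> bool" where
  "gauge_rough_path D \<psi> U g T p \<omega> x y y' \<longleftrightarrow>
     (\<exists>C>0. \<exists>\<delta>>0. \<forall>s t. 0 \<le> s \<and> s \<le> t \<and> t \<le> T \<and> t - s \<le> \<delta> \<longrightarrow>
        (y s, y t) \<in> D \<and>
        metric_norm g (y s) (\<psi> (y s) (y t) - y' s (x t - x s)) \<le> C * \<omega> s t powr (2 / p) \<and>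
        metric_onorm g (y s) (\<lambda>w. U (y s) (y t) (y' t w) - y' s w) \<le> C * \<omega> s t powr (1 / p))"

end

theory Submission
  imports Defs
begin

text \<open>Everything is local. In a chart around a point of the path, a logarithm satisfies
  \<open>\<psi>(z, w) = w - z + O(\<bar>w - z\<bar>\<^sup>2)\<close> (it vanishes on the diagonal, its second partial derivative is
  the identity there and is locally Lipschitz), a parallelism satisfies
  \<open>U(z, w) = I + O(\<bar>w - z\<bar>)\<close>, and the Riemannian norm is comparable with the norm of the model space.
  Either pair of conditions forces \<open>\<bar>z\<^sub>t - z\<^sub>s\<bar> = O(\<omega>(s, t)\<^bsup>1/p\<^esup>)\<close>, so the gauge increments and the
  chart increments differ by \<open>O(\<omega>(s, t)\<^bsup>2/p\<^esup>)\<close> and \<open>O(\<omega>(s, t)\<^bsup>1/p\<^esup>)\<close> respectively. Compactness of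
  the time interval globalises: the gauge estimates are only required for small \<open>t - s\<close>, while the
  chart estimates on adjacent intervals can be concatenated by superadditivity of \<open>\<omega>\<close>.\<close>

section \<open>Finite-dimensional inner product spaces\<close>

text \<open>The quadratic error of the logarithm is harmless only once the chart increment
  \<open>a\<close> is known to be of order \<open>h = \<omega> s t powr (1 / p)\<close>. The chart
  conditions give this at once, since they bound \<open>a\<close> minus a term of that order; the
  gauge conditions bound the logarithm instead. The circle is broken by shrinking the neighbourhood
  until \<open>K * norm a \<le> 1 / 2\<close>: the error is then at most half of \<open>a\<close>
  and can be absorbed. The neighbourhood of a time has to be fixed before the constant of the given
  estimate is known, because a chart constant belongs to an interval that is itself chosen inside
  that neighbourhood. \<open>Ck_on\<close> records derivatives one direction at a time, so uniform
  bounds are obtained on finitely many basis vectors and then combined. Dimension zero is allowed,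
  so a basis or a unit sphere may be empty.\<close>

lemma fin_dim_orthonormal_basis:
  obtains B :: "'a::fin_dim_inner set" where "finite B" "\<And>b. b \<in> B \<Longrightarrow> norm b = 1"
    "\<And>x. (\<Sum>b\<in>B. (x \<bullet> b) *\<^sub>R b) = x"
proof -
  obtain B0 :: "'a set" where B0: "finite B0" "\<And>x. \<exists>u. x = (\<Sum>b\<in>B0. u b *\<^sub>R b)"
    using ex_finite_spanning by blast
  have "span B0 = UNIV"
    using B0 by (auto simp: span_finite)
  then obtain C where C: "finite C" "span C = (UNIV :: 'a set)" "pairwise orthogonal C"
    using basis_orthogonal[OF B0(1)] by metis
  \<comment> \<open>An orthogonal spanning set may contain \<open>0\<close>, which cannot be
    normalised; dropping it does not change the span.\<close>
  define B where "B = sgn ` (C - {0})"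
  have fin: "finite B" using C by (simp add: B_def)
  have n1: "norm b = 1" if "b \<in> B" for b
    using that by (auto simp: B_def norm_sgn split: if_splits)
  have orth: "b \<bullet> b' = 0" if "b \<in> B" "b' \<in> B" "b \<noteq> b'" for b b'
    using that C(3) by (fastforce simp: B_def pairwise_def orthogonal_def sgn_div_norm)
  have "c \<in> span B" if "c \<in> C" for c
  proof (cases "c = 0")
    case False
    then have "norm c *\<^sub>R sgn c \<in> span B"
      using that by (intro span_scale span_base) (auto simp: B_def)
    then show ?thesis using False by (simp add: sgn_div_norm)
  qed (simp add: span_zero)
  then have sp: "span B = UNIV"
    by (metis C(2) span_minimal subsetI subspace_span top.extremum_uniqueI)
  have "(\<Sum>b\<in>B. (x \<bullet> b) *\<^sub>R b) = x" for x
  proof -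
    obtain u where u: "x = (\<Sum>b\<in>B. u b *\<^sub>R b)"
      using sp span_finite[OF fin] by auto
    have "x \<bullet> b = u b" if "b \<in> B" for b
    proof -
      have "x \<bullet> b = (\<Sum>b'\<in>B. u b' * (b' \<bullet> b))"
        by (simp add: u inner_sum_left)
      also have "\<dots> = (\<Sum>b'\<in>B. if b' = b then u b else 0)"
        using that n1[OF that] orth by (intro sum.cong) (auto simp: dot_square_norm)
      finally show ?thesis using that fin by simp
    qed
    then show ?thesis using u by simp
  qed
  then show ?thesis using that fin n1 by blast
qed

text \<open>Each coordinate \<open>x \<bullet> b\<close> is at most \<open>norm x\<close> by
  Cauchy-Schwarz. Bounds on the values at basis vectors thus become an operator bound, at the price
  of the factor \<open>card B\<close>.\<close>

lemma linear_norm_le_basis: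
  fixes f :: "'a::real_inner \<Rightarrow> 'b::real_normed_vector"
  assumes B: "\<And>b. b \<in> B \<Longrightarrow> norm b = 1" "\<And>x. (\<Sum>b\<in>B. (x \<bullet> b) *\<^sub>R b) = x"
    and "linear f" and K: "\<And>b. b \<in> B \<Longrightarrow> norm (f b) \<le> K"
  shows "norm (f x) \<le> real (card B) * K * norm x"
proof -
  have "f x = (\<Sum>b\<in>B. (x \<bullet> b) *\<^sub>R f b)"
    by (metis (mono_tags, lifting) B(2) \<open>linear f\<close> linear_scale linear_sum sum.cong)
  also have "norm \<dots> \<le> (\<Sum>b\<in>B. norm x * K)"
  proof (intro order_trans[OF norm_sum] sum_mono)
    fix b assume "b \<in> B"
    then have "\<bar>x \<bullet> b\<bar> \<le> norm x"
      using Cauchy_Schwarz_ineq2[of x b] B(1) by simp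
    then show "norm ((x \<bullet> b) *\<^sub>R f b) \<le> norm x * K"
      using K[OF \<open>b \<in> B\<close>] by (simp add: mult_mono)
  qed
  finally show ?thesis by (simp add: mult_ac)
qed

lemma fin_dim_linear_bounded:
  fixes f :: "'a::fin_dim_inner \<Rightarrow> 'b::real_normed_vector"
  assumes "linear f"
  shows "bounded_linear f"
proof -
  obtain B :: "'a set" where B: "finite B" "\<And>b. b \<in> B \<Longrightarrow> norm b = 1"
    "\<And>x. (\<Sum>b\<in>B. (x \<bullet> b) *\<^sub>R b) = x"
    using fin_dim_orthonormal_basis by blast
  have "norm (f x) \<le> norm x * (real (card B) * (\<Sum>b\<in>B. norm (f b)))" for x
  proof -
    have "norm (f b) \<le> (\<Sum>b\<in>B. norm (f b))" if "b \<in> B" for b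
      using that B(1) by (intro member_le_sum) auto
    from linear_norm_le_basis[OF B(2,3) assms this, of x] show ?thesis
      by (simp add: mult_ac)
  qed
  then show ?thesis
    using assms by (intro bounded_linear_intro[where K = "real (card B) * (\<Sum>b\<in>B. norm (f b))"])
      (auto simp: linear_add linear_scale)
qed

text \<open>Coordinates of a unit vector lie in \<open>[-1, 1]\<close>, so the sphere is a closed
  subset of a compact set containing the image of a cube; that set is built by adding one basis
  direction at a time.\<close>

lemma fin_dim_compact_sphere: "compact {a :: 'a::fin_dim_inner. norm a = 1}"
proof -
  obtain B :: "'a set" where B: "finite B" "\<And>b. b \<in> B \<Longrightarrow> norm b = 1"
    "\<And>x. (\<Sum>b\<in>B. (x \<bullet> b) *\<^sub>R b) = x"
    using fin_dim_orthonormal_basis by blast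
  have box: "\<exists>S. compact S \<and> (\<forall>u. (\<forall>b\<in>B'. \<bar>u b\<bar> \<le> 1) \<longrightarrow> (\<Sum>b\<in>B'. u b *\<^sub>R b) \<in> S)"
    if "finite B'" for B' :: "'a set"
    using that
  proof induction
    case empty
    show ?case by (intro exI[of _ "{0}"]) simp
  next
    case (insert b B')
    then obtain S where S: "compact S"
      "\<And>u. \<forall>b\<in>B'. \<bar>u b\<bar> \<le> 1 \<Longrightarrow> (\<Sum>b\<in>B'. u b *\<^sub>R b) \<in> S" by blast
    let ?S = "(\<lambda>(r, k). r *\<^sub>R b + k) ` ({-1..1} \<times> S)"
    have "compact ?S"
      by (intro compact_continuous_image compact_Times S compact_Icc)
        (auto simp: case_prod_beta intro!: continuous_intros)
    moreover have "(\<Sum>b\<in>insert b B'. u b *\<^sub>R b) \<in> ?S"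
      if u: "\<forall>b\<in>insert b B'. \<bar>u b\<bar> \<le> 1" for u
      using insert S(2)[of u] u by (auto intro!: image_eqI[where x = "(u b, \<Sum>b\<in>B'. u b *\<^sub>R b)"])
    ultimately show ?case by blast
  qed
  obtain S where S: "compact S" "\<And>u. \<forall>b\<in>B. \<bar>u b\<bar> \<le> 1 \<Longrightarrow> (\<Sum>b\<in>B. u b *\<^sub>R b) \<in> S"
    using box[OF B(1)] by blast
  have "a \<in> S" if "norm a = 1" for a
  proof -
    have "\<bar>a \<bullet> b\<bar> \<le> 1" if "b \<in> B" for b
      using Cauchy_Schwarz_ineq2[of a b] B(2)[OF that] \<open>norm a = 1\<close> by simp
    then show ?thesis
      using S(2)[of "\<lambda>b. a \<bullet> b"] B(3) by simp
  qed
  then have eq: "{a. norm a = 1} = S \<inter> {a. norm a = 1}" by blast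
  have "closed {a :: 'a. norm a = 1}"
    by (intro closed_Collect_eq continuous_intros)
  then show ?thesis
    by (subst eq) (rule compact_Int_closed[OF S(1)])
qed

text \<open>Local representatives of a gauge are functions on \<open>'e \<times> 'e\<close>, and the
  Lipschitz estimate below has to apply to them.\<close>

instance prod :: (fin_dim_inner, fin_dim_inner) fin_dim_inner
proof
  obtain B :: "'a set" where B: "finite B" "\<And>x. (\<Sum>b\<in>B. (x \<bullet> b) *\<^sub>R b) = x"
    using fin_dim_orthonormal_basis by metis
  obtain C :: "'b set" where C: "finite C" "\<And>x. (\<Sum>b\<in>C. (x \<bullet> b) *\<^sub>R b) = x"
    using fin_dim_orthonormal_basis by metis
  let ?B = "(\<lambda>b. (b, 0)) ` B \<union> Pair 0 ` C :: ('a \<times> 'b) set"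
  have "x \<in> span ?B" for x
  proof -
    have "(fst x, 0) = (\<Sum>b\<in>B. (fst x \<bullet> b) *\<^sub>R (b, 0 :: 'b))"
      using B by (simp add: prod_eq_iff fst_sum snd_sum)
    also have "\<dots> \<in> span ?B" by (intro span_sum span_scale span_base) auto
    finally have 1: "(fst x, 0) \<in> span ?B" .
    have "(0, snd x) = (\<Sum>b\<in>C. (snd x \<bullet> b) *\<^sub>R (0 :: 'a, b))"
      using C by (simp add: prod_eq_iff fst_sum snd_sum)
    also have "\<dots> \<in> span ?B" by (intro span_sum span_scale span_base) auto
    finally have "(0, snd x) \<in> span ?B" .
    from span_add[OF 1 this] show ?thesis by simp
  qed
  moreover have "finite ?B" using B C by simp
  ultimately show "\<exists>B::('a \<times> 'b) set. finite B \<and> (\<forall>x. \<exists>u. x = (\<Sum>b\<in>B. u b *\<^sub>R b))"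
    using span_finite[of ?B] by (intro exI[of _ ?B]) (auto simp: set_eq_iff image_iff)
qed

section \<open>Local estimates for smooth maps\<close>

text \<open>Openness of \<open>S\<close> carries pointwise agreement over to the derivatives, order
  by order. This allows a composite with \<open>cinv\<close> to be replaced by an explicit
  formula.\<close>

lemma Ck_on_cong:
  assumes "open S" "\<And>z. z \<in> S \<Longrightarrow> f z = g z"
  shows "Ck_on n S f \<longleftrightarrow> Ck_on n S g"
  using assms(2)
proof (induction n arbitrary: f g)
  case 0
  then show ?case by (simp cong: continuous_on_cong)
next
  case (Suc n)
  have hd: "(f has_derivative f') (at z) \<longleftrightarrow> (g has_derivative f') (at z)" if "z \<in> S" for z f'
    using has_derivative_transform_within_open[OF _ assms(1) that] Suc.prems by metis
  then have "frechet_derivative f (at z) = frechet_derivative g (at z)" if "z \<in> S" for z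
    using that by (simp add: frechet_derivative_def)
  then show ?case
    using Suc.IH[of "\<lambda>z. frechet_derivative f (at z) v" "\<lambda>z. frechet_derivative g (at z) v" for v]
    using hd by (auto simp: differentiable_def)
qed

lemma Ck_on_bounded_linear:
  assumes "open S" "bounded_linear h" "Ck_on n S f"
  shows "Ck_on n S (\<lambda>z. h (f z))"
  using assms(3)
proof (induction n arbitrary: f)
  case 0
  then show ?case using assms(2) by (simp add: bounded_linear.continuous_on)
next
  case (Suc n)
  have hd: "((\<lambda>z. h (f z)) has_derivative (\<lambda>v. h (frechet_derivative f (at z) v))) (at z)"
    if "z \<in> S" for z
    using Suc.prems that frechet_derivative_works by (intro bounded_linear.has_derivative[OF assms(2)]) auto
  have "Ck_on n S (\<lambda>z. h (frechet_derivative f (at z) v))" for v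
    using Suc by simp
  moreover have "Ck_on n S (\<lambda>z. frechet_derivative (\<lambda>z. h (f z)) (at z) v)
      \<longleftrightarrow> Ck_on n S (\<lambda>z. h (frechet_derivative f (at z) v))" for v
    using hd by (intro Ck_on_cong assms) (metis frechet_derivative_at)
  ultimately show ?case
    using hd by (auto simp: differentiable_def)
qed

lemma smooth_on_cong:
  assumes "open S" "\<And>z. z \<in> S \<Longrightarrow> f z = g z"
  shows "smooth_on S f \<longleftrightarrow> smooth_on S g"
  using Ck_on_cong[OF assms] by (simp add: smooth_on_def)

text \<open>Used with \<open>snd\<close> as \<open>h\<close>, to pass from the local representative
  of a bundle-valued map to its fibre component.\<close>

lemma smooth_on_bounded_linear:
  assumes "open S" "bounded_linear h" "smooth_on S f"
  shows "smooth_on S (\<lambda>z. h (f z))"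
  using assms Ck_on_bounded_linear[OF assms(1,2)] by (simp add: smooth_on_def)

text \<open>Mean value inequality on a ball: the derivatives along basis vectors are continuous,
  hence bounded near \<open>z0\<close>, and together they bound the operator norm.\<close>

lemma Ck_1_locally_Lipschitz:
  fixes f :: "'a::fin_dim_inner \<Rightarrow> 'b::real_normed_vector"
  assumes "Ck_on 1 S f" "open S" "z0 \<in> S"
  obtains r L where "r > 0" "L \<ge> 0" "ball z0 r \<subseteq> S"
    "\<And>z w. z \<in> ball z0 r \<Longrightarrow> w \<in> ball z0 r \<Longrightarrow> norm (f z - f w) \<le> L * norm (z - w)"
proof -
  obtain B :: "'a set" where B: "finite B" "\<And>b. b \<in> B \<Longrightarrow> norm b = 1"
    "\<And>x. (\<Sum>b\<in>B. (x \<bullet> b) *\<^sub>R b) = x"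
    using fin_dim_orthonormal_basis by blast
  let ?D = "\<lambda>z. frechet_derivative f (at z)"
  have cont: "continuous_on S (\<lambda>z. ?D z v)" for v
    using assms(1) by simp
  \<comment> \<open>\<open>F\<close> dominates all basis derivatives at once, so one radius serves
    every direction; on it \<open>F z \<le> F z0 + 1\<close>, which is the source of
    \<open>L\<close>.\<close>
  define F where "F z = (\<Sum>b\<in>B. norm (?D z b))" for z
  have "continuous_on S F"
    unfolding F_def by (intro continuous_intros cont)
  then have "isCont F z0"
    using assms by (simp add: continuous_on_eq_continuous_at)
  then obtain r1 where r1: "r1 > 0" "\<And>z. dist z z0 < r1 \<Longrightarrow> dist (F z) (F z0) < 1"
    unfolding continuous_at_eps_delta by (metis zero_less_one)
  obtain r2 where r2: "r2 > 0" "ball z0 r2 \<subseteq> S"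
    using openE[OF assms(2,3)] by blast
  define r where "r = min r1 r2"
  define L where "L = real (card B) * (F z0 + 1)"
  have F0: "F z \<ge> 0" for z by (simp add: F_def sum_nonneg)
  have sub: "ball z0 r \<subseteq> S" using r2 by (auto simp: r_def)
  have hd: "(f has_derivative ?D z) (at z)" if "z \<in> S" for z
    using assms(1) that by (simp add: frechet_derivative_works)
  have L0: "L \<ge> 0" using F0 by (simp add: L_def add_nonneg_nonneg)
  have on: "onorm (?D z) \<le> L" if "z \<in> ball z0 r" for z
  proof (rule onorm_bound[OF L0])
    fix v
    have lin: "linear (?D z)"
      using hd sub that has_derivative_linear by blast
    have "F z \<le> F z0 + 1"
      using r1(2)[of z] that by (auto simp: r_def dist_real_def dist_commute)
    moreover have "norm (?D z b) \<le> F z" if "b \<in> B" for b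
      unfolding F_def using that B(1) by (intro member_le_sum) auto
    ultimately show "norm (?D z v) \<le> L * norm v"
      using linear_norm_le_basis[OF B(2,3) lin, of "F z0 + 1" v] by (force simp: L_def)
  qed
  show ?thesis
  proof
    show "r > 0" using r1 r2 by (simp add: r_def)
    show "L \<ge> 0" by (rule L0)
    show "ball z0 r \<subseteq> S" by (rule sub)
    fix z w assume "z \<in> ball z0 r" "w \<in> ball z0 r"
    then show "norm (f z - f w) \<le> L * norm (z - w)"
      using has_derivative_at_withinI[OF hd[OF subsetD[OF sub]]] on
      by (intro differentiable_bound[of "ball z0 r" f ?D]) auto
  qed
qed

text \<open>Apply the mean value inequality to \<open>\<Psi> (z, u) - (u - z)\<close> for
  \<open>u\<close> on the segment from \<open>z\<close> to \<open>w\<close>. The derivative in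
  \<open>u\<close> vanishes at \<open>u = z\<close> and is Lipschitz, so it is of order
  \<open>norm (w - z)\<close> on the whole segment; the length of the segment supplies the second
  factor.\<close>

lemma logarithm_second_order:
  fixes \<Psi> :: "'e::fin_dim_inner \<times> 'e \<Rightarrow> 'e"
  assumes "Ck_on 2 V \<Psi>" "open V" "(z0, z0) \<in> V"
    and zero: "\<And>z. (z, z) \<in> V \<Longrightarrow> \<Psi> (z, z) = 0"
    and diff: "\<And>z a. (z, z) \<in> V \<Longrightarrow> frechet_derivative (\<lambda>w. \<Psi> (z, w)) (at z) a = a"
  obtains r K where "r > 0" "K \<ge> 0"
    "\<And>z w. z \<in> ball z0 r \<Longrightarrow> w \<in> ball z0 r \<Longrightarrow> (z, w) \<in> V \<and>
       norm (\<Psi> (z, w) - (w - z)) \<le> K * (norm (w - z))\<^sup>2"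
proof -
  obtain B :: "'e set" where B: "finite B" "\<And>b. b \<in> B \<Longrightarrow> norm b = 1"
    "\<And>x. (\<Sum>b\<in>B. (x \<bullet> b) *\<^sub>R b) = x"
    using fin_dim_orthonormal_basis by blast
  let ?D = "\<lambda>p. frechet_derivative \<Psi> (at p)"
  have C1: "Ck_on 1 V (\<lambda>p. ?D p v)" for v
    using assms(1) unfolding numeral_2_eq_2 One_nat_def Ck_on.simps(2)[of "Suc 0"] by blast
  have "\<exists>r>0. \<exists>L\<ge>0. ball (z0, z0) r \<subseteq> V \<and> (\<forall>p\<in>ball (z0, z0) r. \<forall>q\<in>ball (z0, z0) r.
      norm (?D p v - ?D q v) \<le> L * norm (p - q))" for v
    using Ck_1_locally_Lipschitz[OF C1 assms(2,3)] by metis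
  then obtain R L where RL: "\<And>v. R v > 0" "\<And>v. L v \<ge> 0" "\<And>v. ball (z0, z0) (R v) \<subseteq> V"
    "\<And>v p q. p \<in> ball (z0, z0) (R v) \<Longrightarrow> q \<in> ball (z0, z0) (R v) \<Longrightarrow>
       norm (?D p v - ?D q v) \<le> L v * norm (p - q)"
    by metis
  \<comment> \<open>The element \<open>R 0\<close> keeps \<open>S\<close> nonempty when the basis is
    empty. The halving in \<open>r\<close> makes a pair of points of \<open>ball z0 r\<close> lie in
    the ball of radius \<open>2 * r\<close> of the product.\<close>
  define S where "S = insert (R 0) ((\<lambda>b. R (0, b)) ` B)"
  define r where "r = Min S / 2"
  define M where "M = (\<Sum>b\<in>B. L (0, b))"
  define K where "K = real (card B) * M"
  have S: "finite S" "S \<noteq> {}" using B by (auto simp: S_def)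
  then have r0: "r > 0" using RL by (auto simp: r_def S_def)
  have "2 * r \<le> R 0" "\<And>b. b \<in> B \<Longrightarrow> 2 * r \<le> R (0, b)"
    using S by (auto simp: r_def S_def)
  moreover have in_ball: "(z, w) \<in> ball (z0, z0) (2 * r)" if "z \<in> ball z0 r" "w \<in> ball z0 r" for z w
    using that sqrt_sum_squares_le_sum_abs[of "dist z0 z" "dist z0 w"] by (simp add: dist_Pair_Pair)
  ultimately have inB: "(z, w) \<in> ball (z0, z0) (R 0)" "\<And>b. b \<in> B \<Longrightarrow> (z, w) \<in> ball (z0, z0) (R (0, b))"
    if "z \<in> ball z0 r" "w \<in> ball z0 r" for z w
    using that by force+
  then have inV: "(z, w) \<in> V" if "z \<in> ball z0 r" "w \<in> ball z0 r" for z w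
    using that RL(3) by blast
  have M0: "M \<ge> 0" unfolding M_def by (intro sum_nonneg RL)
  then have K0: "K \<ge> 0" by (simp add: K_def)
  \<comment> \<open>The partial derivative in the second slot is the full derivative on vectors
    \<open>(0, a)\<close>; hence only the directions \<open>(0, b)\<close> enter the
    constants.\<close>
  have hd: "((\<lambda>w. \<Psi> (z, w)) has_derivative (\<lambda>a. ?D (z, w) (0, a))) (at w)" if "(z, w) \<in> V" for z w
  proof -
    have "(\<Psi> has_derivative ?D (z, w)) (at (z, w))"
      using assms(1) that by (auto simp: numeral_2_eq_2 frechet_derivative_works)
    then show ?thesis
      by (intro has_derivative_compose[of "Pair z" "Pair 0" w UNIV \<Psi>]) (auto intro!: derivative_eq_intros)
  qed
  have id: "?D (z, z) (0, a) = a" if "(z, z) \<in> V" for z a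
    using diff[OF that] frechet_derivative_at[OF hd[OF that]] by metis
  show ?thesis
  proof
    show "r > 0" by (rule r0)
    show "K \<ge> 0" by (rule K0)
    fix z w assume z: "z \<in> ball z0 r" and w: "w \<in> ball z0 r"
    let ?f = "\<lambda>u. \<Psi> (z, u) - (u - z)"
    have sub: "closed_segment z w \<subseteq> ball z0 r"
      using z w by (simp add: closed_segment_subset)
    have "norm (?f w - ?f z) \<le> K * norm (w - z) * norm (w - z)"
    proof (rule differentiable_bound[of "closed_segment z w"])
      fix u assume u: "u \<in> closed_segment z w"
      then have u': "u \<in> ball z0 r" using sub by blast
      have hdu: "(?f has_derivative (\<lambda>a. ?D (z, u) (0, a) - a)) (at u)"
        using hd[OF inV[OF z u']] by (auto intro!: derivative_eq_intros)
      then show "(?f has_derivative (\<lambda>a. ?D (z, u) (0, a) - a)) (at u within closed_segment z w)"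
        by (rule has_derivative_at_withinI)
      \<comment> \<open>On the diagonal the partial derivative is the identity, so \<open>b\<close>
        may be replaced by its value at \<open>(z, z)\<close> and the Lipschitz bound
        applies.\<close>
      have "norm (?D (z, u) (0, b) - b) \<le> M * norm (w - z)" if "b \<in> B" for b
      proof -
        have "norm (?D (z, u) (0, b) - ?D (z, z) (0, b)) \<le> L (0, b) * norm ((z, u) - (z, z))"
          using inB z u' that by (intro RL(4)) auto
        also have "norm ((z, u) - (z, z)) = norm (u - z)"
          by (simp add: norm_prod_def)
        also have "norm (u - z) \<le> norm (w - z)"
          using segment_bound(1)[OF u] by (simp add: norm_minus_commute)
        finally have "norm (?D (z, u) (0, b) - b) \<le> L (0, b) * norm (w - z)"
          using RL(2)[of "(0, b)"] id[OF inV[OF z z]] by (simp add: mult_left_mono)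
        moreover have "L (0, b) \<le> M"
          unfolding M_def using B(1) that RL(2) by (intro member_le_sum) auto
        ultimately show ?thesis
          by (meson mult_right_mono norm_ge_zero order_trans)
      qed
      then have "norm (?D (z, u) (0, a) - a) \<le> K * norm (w - z) * norm a" for a
        using linear_norm_le_basis[OF B(2,3) has_derivative_linear[OF hdu], of "M * norm (w - z)" a]
        by (simp add: K_def mult_ac)
      then show "onorm (\<lambda>a. ?D (z, u) (0, a) - a) \<le> K * norm (w - z)"
        using K0 by (intro onorm_bound) auto
    qed auto
    then show "(z, w) \<in> V \<and> norm (\<Psi> (z, w) - (w - z)) \<le> K * (norm (w - z))\<^sup>2"
      using inV[OF z w] zero[OF inV[OF z z]] by (simp add: power2_eq_square mult_ac)
  qed
qed

text \<open>At \<open>z0\<close> compactness of the unit sphere and homogeneity pin the quadratic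
  form between two multiples of the squared norm. Its finitely many coefficients vary continuously,
  which extends the bounds to nearby \<open>z\<close>.\<close>

lemma inner_products_locally_equivalent:
  fixes G :: "'e::fin_dim_inner \<Rightarrow> 'e \<Rightarrow> 'e \<Rightarrow> real"
  assumes "open S" "z0 \<in> S"
    and lin: "\<And>z a. z \<in> S \<Longrightarrow> linear (G z a)" "\<And>z b. z \<in> S \<Longrightarrow> linear (\<lambda>a. G z a b)"
    and pos: "\<And>z a. z \<in> S \<Longrightarrow> a \<noteq> 0 \<Longrightarrow> G z a a > 0"
    and cont: "\<And>a b. continuous_on S (\<lambda>z. G z a b)"
  obtains r k K where "r > 0" "k > 0" "K > 0" "ball z0 r \<subseteq> S"
    "\<And>z a. z \<in> ball z0 r \<Longrightarrow> k * (norm a)\<^sup>2 \<le> G z a a \<and> G z a a \<le> K * (norm a)\<^sup>2"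
proof -
  obtain B :: "'e set" where B: "finite B" "\<And>b. b \<in> B \<Longrightarrow> norm b = 1"
    "\<And>x. (\<Sum>b\<in>B. (x \<bullet> b) *\<^sub>R b) = x"
    using fin_dim_orthonormal_basis by blast
  have expand: "G z a a = (\<Sum>b\<in>B. \<Sum>b'\<in>B. (a \<bullet> b) * (a \<bullet> b') * G z b b')" if "z \<in> S" for z a
  proof -
    have 1: "G z (\<Sum>b\<in>B. u b *\<^sub>R b) c = (\<Sum>b\<in>B. u b * G z b c)" for u c
      by (simp add: linear_sum[OF lin(2)[OF that]] linear_scale[OF lin(2)[OF that]])
    have 2: "G z c (\<Sum>b\<in>B. u b *\<^sub>R b) = (\<Sum>b\<in>B. u b * G z c b)" for u c
      by (simp add: linear_sum[OF lin(1)[OF that]] linear_scale[OF lin(1)[OF that]])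
    have "G z a a = G z (\<Sum>b\<in>B. (a \<bullet> b) *\<^sub>R b) (\<Sum>b\<in>B. (a \<bullet> b) *\<^sub>R b)"
      by (simp add: B)
    also have "\<dots> = (\<Sum>b\<in>B. (a \<bullet> b) * (\<Sum>b'\<in>B. (a \<bullet> b') * G z b b'))"
      by (subst 1) (simp only: 2)
    finally show ?thesis by (simp add: sum_distrib_left mult_ac)
  qed
  define Q where "Q a = G z0 a a" for a
  \<comment> \<open>In coordinates \<open>Q\<close> is a quadratic polynomial.\<close>
  have "continuous_on UNIV Q"
    unfolding Q_def expand[OF assms(2)] by (intro continuous_intros)
  then have contQ: "continuous_on X Q" for X
    using continuous_on_subset by blast
  have "\<exists>k>0. \<exists>K>0. \<forall>a. norm a = 1 \<longrightarrow> k \<le> Q a \<and> Q a \<le> K"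
  \<comment> \<open>In dimension zero there are no unit vectors, and any positive constants will
    do.\<close>
  proof (cases "{a::'e. norm a = 1} = {}")
    case True
    then show ?thesis by (intro exI[of _ 1] conjI) auto
  next
    case False
    obtain a where a: "norm a = 1" "\<And>a'. norm a' = 1 \<Longrightarrow> Q a \<le> Q a'"
      using continuous_attains_inf[OF fin_dim_compact_sphere False contQ] by auto
    obtain d where d: "norm d = 1" "\<And>a'. norm a' = 1 \<Longrightarrow> Q a' \<le> Q d"
      using continuous_attains_sup[OF fin_dim_compact_sphere False contQ] by auto
    have "Q a > 0" "Q d > 0"
      using a d pos[OF assms(2)] by (force simp: Q_def)+
    then show ?thesis using a d by metis
  qed
  then obtain k K where kK: "k > 0" "K > 0" "\<And>a. norm a = 1 \<Longrightarrow> k \<le> Q a \<and> Q a \<le> K" by blast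
  have Q: "k * (norm a)\<^sup>2 \<le> Q a \<and> Q a \<le> K * (norm a)\<^sup>2" for a
  proof (cases "a = 0")
    case True
    then show ?thesis using linear_0[OF lin(1)[OF assms(2)]] by (simp add: Q_def)
  next
    case False
    have "Q (norm a *\<^sub>R sgn a) = (norm a)\<^sup>2 * Q (sgn a)"
      by (simp only: Q_def linear_scale[OF lin(1)[OF assms(2)]] linear_scale[OF lin(2)[OF assms(2)]])
        (simp add: power2_eq_square)
    then have "Q a = (norm a)\<^sup>2 * Q (sgn a)"
      using False by (simp add: sgn_div_norm)
    then show ?thesis
      using kK(3)[of "sgn a"] False by (simp add: norm_sgn)
  qed
  \<comment> \<open>The total deviation of the coefficients; it vanishes at \<open>z0\<close>, so by
    continuity it stays below \<open>k / 2\<close> near \<open>z0\<close>.\<close>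
  define F where "F z = (\<Sum>b\<in>B. \<Sum>b'\<in>B. \<bar>G z b b' - G z0 b b'\<bar>)" for z
  have "continuous_on S F"
    unfolding F_def by (intro continuous_intros cont)
  then have "isCont F z0"
    using assms by (simp add: continuous_on_eq_continuous_at)
  then obtain r1 where r1: "r1 > 0" "\<And>z. dist z z0 < r1 \<Longrightarrow> dist (F z) (F z0) < k / 2"
    unfolding continuous_at_eps_delta using kK(1) by (metis half_gt_zero)
  obtain r2 where r2: "r2 > 0" "ball z0 r2 \<subseteq> S"
    using openE[OF assms(1,2)] by blast
  have dev: "\<bar>G z a a - Q a\<bar> \<le> F z * (norm a)\<^sup>2" if "z \<in> S" for z a
  proof -
    have "G z a a - Q a = (\<Sum>b\<in>B. \<Sum>b'\<in>B. (a \<bullet> b) * (a \<bullet> b') * (G z b b' - G z0 b b'))"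
      by (simp add: Q_def expand that assms(2) sum_subtractf right_diff_distrib)
    also have "\<bar>\<dots>\<bar> \<le> (\<Sum>b\<in>B. \<Sum>b'\<in>B. (norm a)\<^sup>2 * \<bar>G z b b' - G z0 b b'\<bar>)"
    proof (intro order_trans[OF sum_abs] sum_mono)
      fix b b' assume "b \<in> B" "b' \<in> B"
      then have "\<bar>a \<bullet> b\<bar> \<le> norm a" "\<bar>a \<bullet> b'\<bar> \<le> norm a"
        using Cauchy_Schwarz_ineq2[of a] B(2) by (metis mult.right_neutral)+
      then show "\<bar>(a \<bullet> b) * (a \<bullet> b') * (G z b b' - G z0 b b')\<bar> \<le> (norm a)\<^sup>2 * \<bar>G z b b' - G z0 b b'\<bar>"
        by (simp add: abs_mult power2_eq_square mult_mono)
    qed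
    finally show ?thesis
      by (simp add: F_def sum_distrib_left sum_distrib_right mult_ac)
  qed
  show ?thesis
  proof
    \<comment> \<open>A deviation below \<open>k / 2\<close> costs half of the lower constant and
      adds as much to the upper one.\<close>
    show "min r1 r2 > 0" "k / 2 > 0" "K + k / 2 > 0" "ball z0 (min r1 r2) \<subseteq> S"
      using r1 r2 kK by auto
    fix z a :: 'e assume z: "z \<in> ball z0 (min r1 r2)"
    have "\<bar>F z\<bar> < k / 2"
      using r1(2)[of z] z by (simp add: dist_commute F_def)
    then have "F z * (norm a)\<^sup>2 \<le> k / 2 * (norm a)\<^sup>2"
      by (intro mult_right_mono) auto
    then show "k / 2 * (norm a)\<^sup>2 \<le> G z a a \<and> G z a a \<le> (K + k / 2) * (norm a)\<^sup>2"
      using dev[of z a] Q[of a] z r2 by (auto simp: algebra_simps)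
  qed
qed

section \<open>Tangent vectors and gauges in a chart\<close>

lemma cinv_cmap: "topological_chart c \<Longrightarrow> m \<in> cdom c \<Longrightarrow> cinv c (cmap c m) = m"
  by (auto simp: topological_chart_def homeomorphism_def)

lemma smooth_structure_topological_chart:
  "smooth_structure A \<Longrightarrow> c \<in> A \<Longrightarrow> topological_chart c"
  by (simp add: smooth_structure_def)

lemma cmap_image_open:
  assumes "topological_chart c" "open S"
  shows "open (cmap c ` (cdom c \<inter> S))"
proof -
  have "openin (top_of_set (cmap c ` cdom c)) (cmap c ` (cdom c \<inter> S))"
    using assms unfolding topological_chart_def
    by (intro homeomorphism_imp_open_map[where S = "cdom c"]) (auto simp: openin_open_Int)
  then show ?thesis
    using assms openin_open_eq by (auto simp: topological_chart_def)
qed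

lemma transition_has_derivative:
  assumes "smooth_structure A" "c \<in> A" "c' \<in> A" "m \<in> cdom c" "m \<in> cdom c'"
  shows "((cmap c' \<circ> cinv c) has_derivative transition_deriv c c' m) (at (cmap c m))"
proof -
  have "Ck_on 1 (cmap c ` (cdom c \<inter> cdom c')) (cmap c' \<circ> cinv c)"
    using assms(1-3) unfolding smooth_structure_def smooth_transition_def smooth_on_def by blast
  then have "(cmap c' \<circ> cinv c) differentiable (at (cmap c m))"
    using assms(4,5) by simp
  then show ?thesis
    by (simp add: transition_deriv_def frechet_derivative_works)
qed

lemma transition_deriv_linear:
  assumes "smooth_structure A" "c \<in> A" "c' \<in> A" "m \<in> cdom c" "m \<in> cdom c'"
  shows "linear (transition_deriv c c' m)"
  using transition_has_derivative[OF assms] has_derivative_linear by blast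

text \<open>\<open>cmap c \<circ> cinv c\<close> is the identity on the chart image, and that image
  is open, so the derivatives agree.\<close>

lemma transition_deriv_refl:
  assumes "smooth_structure A" "c \<in> A" "m \<in> cdom c"
  shows "transition_deriv c c m a = a"
proof -
  have tc: "topological_chart c"
    using assms smooth_structure_topological_chart by blast
  have "((cmap c \<circ> cinv c) has_derivative (\<lambda>a. a)) (at (cmap c m))"
    by (rule has_derivative_transform_within_open[OF has_derivative_ident cmap_image_open[OF tc open_UNIV]])
      (use assms cinv_cmap[OF tc] in auto)
  then show ?thesis
    using transition_has_derivative[of A c c m] assms has_derivative_unique by metis
qed

text \<open>Chain rule: the composite of the two transitions equals the direct one on the open image
  of \<open>cdom c \<inter> cdom c'\<close>, and derivatives are unique. This is the cocycle
  identity of the tangent bundle.\<close>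

lemma transition_deriv_trans:
  assumes "smooth_structure A" "c \<in> A" "c' \<in> A" "c'' \<in> A" "m \<in> cdom c" "m \<in> cdom c'" "m \<in> cdom c''"
  shows "transition_deriv c' c'' m (transition_deriv c c' m a) = transition_deriv c c'' m a"
proof -
  have tc: "topological_chart c" "topological_chart c'"
    using assms smooth_structure_topological_chart by blast+
  have "(((cmap c'' \<circ> cinv c') \<circ> (cmap c' \<circ> cinv c)) has_derivative
      (transition_deriv c' c'' m \<circ> transition_deriv c c' m)) (at (cmap c m))"
    using transition_has_derivative[of A c c' m] transition_has_derivative[of A c' c'' m] assms cinv_cmap[OF tc(1)]
    by (intro diff_chain_at) auto
  moreover have "open (cdom c')" using tc by (simp add: topological_chart_def)
  ultimately have "((cmap c'' \<circ> cinv c) has_derivative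
      (transition_deriv c' c'' m \<circ> transition_deriv c c' m)) (at (cmap c m))"
    by (rule has_derivative_transform_within_open[OF _ cmap_image_open[OF tc(1)]])
      (use assms cinv_cmap[OF tc(1)] cinv_cmap[OF tc(2)] in auto)
  then show ?thesis
    using transition_has_derivative[of A c c'' m] assms has_derivative_unique by (metis comp_apply)
qed

text \<open>The cocycle identity is exactly the compatibility condition in
  \<open>tangent_space\<close>.\<close>

lemma coordinate_vector_in_tangent_space:
  assumes "smooth_structure A" "c \<in> A" "m \<in> cdom c"
  shows "coordinate_vector A c m a \<in> tangent_space A m"
  using assms transition_deriv_trans[of A c _ _ m]
  by (auto simp: tangent_space_def coordinate_vector_def)

lemma coordinate_vector_apply:
  assumes "smooth_structure A" "c \<in> A" "m \<in> cdom c"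
  shows "coordinate_vector A c m a c = a"
  using assms transition_deriv_refl by (simp add: coordinate_vector_def)

lemma tangent_vector_transition:
  assumes "v \<in> tangent_space A m" "c \<in> A" "c' \<in> A" "m \<in> cdom c" "m \<in> cdom c'"
  shows "v c' = transition_deriv c c' m (v c)"
  using assms unfolding tangent_space_def by blast

lemma tangent_vector_zero:
  assumes "v \<in> tangent_space A m" "\<not> (c \<in> A \<and> m \<in> cdom c)"
  shows "v c = 0"
  using assms unfolding tangent_space_def by blast

text \<open>With \<open>coordinate_vector_apply\<close> this makes evaluation at \<open>c\<close> a
  bijection from the tangent space onto the model space, which is why all estimates can be made on
  the single coordinate \<open>v c\<close>.\<close>

lemma coordinate_vector_of_tangent:
  assumes "c \<in> A" "m \<in> cdom c" "v \<in> tangent_space A m"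
  shows "coordinate_vector A c m (v c) = v"
proof
  fix c'
  show "coordinate_vector A c m (v c) c' = v c'"
    using tangent_vector_transition[OF assms(3,1) _ assms(2), of c'] tangent_vector_zero[OF assms(3), of c']
    unfolding coordinate_vector_def by presburger
qed

lemma coordinate_vector_linear:
  assumes "smooth_structure A" "c \<in> A" "m \<in> cdom c"
  shows "coordinate_vector A c m (a + b) = coordinate_vector A c m a + coordinate_vector A c m b"
    and "coordinate_vector A c m (r *\<^sub>R a) = r *\<^sub>R coordinate_vector A c m a"
  using transition_deriv_linear[OF assms(1,2) _ assms(3)]
  by (auto simp: coordinate_vector_def fun_eq_iff scaleR_fun_def linear_add linear_scale)

lemma tangent_space_diff:
  assumes "smooth_structure A" "u \<in> tangent_space A m" "v \<in> tangent_space A m"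
  shows "u - v \<in> tangent_space A m"
  unfolding tangent_space_def
proof (intro CollectI conjI ballI allI impI)
  fix c c' assume "c \<in> A" "c' \<in> A" "m \<in> cdom c \<inter> cdom c'"
  then have c: "c \<in> A" "c' \<in> A" "m \<in> cdom c" "m \<in> cdom c'" by auto
  have "u c' = transition_deriv c c' m (u c)" "v c' = transition_deriv c c' m (v c)"
    using assms(2,3) c by (blast intro: tangent_vector_transition)+
  then show "(u - v) c' = transition_deriv c c' m ((u - v) c)"
    using linear_diff[OF transition_deriv_linear[OF assms(1) c]] by simp
next
  fix c assume "\<not> (c \<in> A \<and> m \<in> cdom c)"
  then show "(u - v) c = 0"
    using tangent_vector_zero[OF assms(2)] tangent_vector_zero[OF assms(3)] by simp
qed

section \<open>Local representatives of logarithms and parallelisms\<close>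

lemma smooth_on_imp_continuous_on: "smooth_on S f \<Longrightarrow> continuous_on S f"
  unfolding smooth_on_def using Ck_on.simps(1) by blast

lemma smooth_map_onD:
  assumes "smooth_map_on A B S f" "c \<in> A" "c' \<in> B" "{p \<in> cdom c \<inter> S. f p \<in> cdom c'} = X"
  shows "open (cmap c ` X)" "smooth_on (cmap c ` X) (cmap c' \<circ> f \<circ> cinv c)"
proof -
  have "let V = cmap c ` {p \<in> cdom c \<inter> S. f p \<in> cdom c'} in open V \<and> smooth_on V (cmap c' \<circ> f \<circ> cinv c)"
    using assms(1-3) unfolding smooth_map_on_def by blast
  then show "open (cmap c ` X)" "smooth_on (cmap c ` X) (cmap c' \<circ> f \<circ> cinv c)"
    unfolding assms(4) Let_def by blast+
qed

text \<open>The same \<open>c\<close> is used for both base points and for the fibre. In the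
  resulting charts the map has the representative \<open>(z, w) \<mapsto> (z, \<psi> ...)\<close>,
  of which only the second component is kept.\<close>

lemma logarithm_in_chart:
  assumes "smooth_structure A" "is_logarithm A D \<psi>" "c \<in> A"
  defines "V \<equiv> map_prod (cmap c) (cmap c) ` ((cdom c \<times> cdom c) \<inter> D)"
  shows "open V" "smooth_on V (\<lambda>(z, w). \<psi> (cinv c z) (cinv c w) c)"
proof -
  let ?pc = "(cdom c \<times> cdom c, map_prod (cmap c) (cmap c))"
  let ?tc = "({(m, v). m \<in> cdom c \<and> v \<in> tangent_space A m},
      \<lambda>(m, v). (cmap c m, chart_differential c v))"
  let ?f = "\<lambda>(m, n). (m, \<psi> m n)"
  have tc: "topological_chart c"
    using assms smooth_structure_topological_chart by blast
  have "inj_on (cmap c) (cdom c)"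
    using cinv_cmap[OF tc] by (metis inj_on_inverseI)
  then have inj: "inj_on (map_prod (cmap c) (cmap c)) (cdom c \<times> cdom c)"
    by (simp add: map_prod_inj_on)
  have pc: "?pc \<in> product_atlas A"
    unfolding product_atlas_def using assms(3) by (intro image_eqI[of _ _ "(c, c)"]) auto
  have tca: "?tc \<in> tangent_atlas A"
    unfolding tangent_atlas_def using assms(3) by (intro image_eqI[of _ _ c]) auto
  \<comment> \<open>On \<open>D\<close> the value \<open>\<psi> m n\<close> is tangent at
    \<open>m\<close>, so membership in the tangent chart only asks that
    \<open>m \<in> cdom c\<close>.\<close>
  have dom: "{p \<in> cdom ?pc \<inter> D. ?f p \<in> cdom ?tc} = (cdom c \<times> cdom c) \<inter> D"
    using assms(2) by (auto simp: is_logarithm_def)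
  have sm: "smooth_map_on (product_atlas A) (tangent_atlas A) D ?f"
    using assms(2) by (simp add: is_logarithm_def)
  have *: "open V" "smooth_on V (cmap ?tc \<circ> ?f \<circ> cinv ?pc)"
    using smooth_map_onD[OF sm pc tca dom] unfolding V_def snd_conv by blast+
  show "open V" by (rule *)
  have eq: "(cmap ?tc \<circ> ?f \<circ> cinv ?pc) p = (fst p, \<psi> (cinv c (fst p)) (cinv c (snd p)) c)" if p: "p \<in> V" for p
  proof -
    obtain m n where mn: "p = (cmap c m, cmap c n)" "m \<in> cdom c" "n \<in> cdom c"
      using p by (auto simp: V_def)
    have "cinv ?pc p = (m, n)"
      using inv_into_f_f[OF inj, of "(m, n)"] mn by (simp add: cinv_def)
    then show ?thesis
      using mn cinv_cmap[OF tc] by (simp add: chart_differential_def)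
  qed
  have "smooth_on V (\<lambda>p. (fst p, \<psi> (cinv c (fst p)) (cinv c (snd p)) c))"
    by (rule iffD1[OF smooth_on_cong[OF *(1) eq] *(2)])
  from smooth_on_bounded_linear[OF *(1) bounded_linear_snd this] show "smooth_on V (\<lambda>(z, w). \<psi> (cinv c z) (cinv c w) c)"
    by (simp add: case_prod_beta')
qed

text \<open>Boundedness is automatic in finite dimension; it is what makes \<open>Blinfun\<close> in
  \<open>tangent_hom_atlas\<close> return the intended map.\<close>

lemma tangent_linear_map_in_chart:
  fixes A :: "('m::topological_space, 'e::fin_dim_inner) chart set"
  assumes "smooth_structure A" "c \<in> A" "n \<in> cdom c" "F \<in> tangent_linear_maps A n m"
  shows "bounded_linear (\<lambda>a. F (coordinate_vector A c n a) c)"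
proof (intro fin_dim_linear_bounded linearI)
  show "F (coordinate_vector A c n (a + b)) c = F (coordinate_vector A c n a) c + F (coordinate_vector A c n b) c" for a b
    using assms(4) coordinate_vector_in_tangent_space[OF assms(1-3)]
    by (simp add: tangent_linear_maps_def coordinate_vector_linear[OF assms(1-3)])
  show "F (coordinate_vector A c n (r *\<^sub>R a)) c = r *\<^sub>R F (coordinate_vector A c n a) c" for r a
    using assms(4) coordinate_vector_in_tangent_space[OF assms(1-3)]
    by (simp add: tangent_linear_maps_def coordinate_vector_linear[OF assms(1-3)] scaleR_fun_def)
qed

lemma parallelism_in_chart:
  assumes "smooth_structure A" "is_parallelism A D U" "c \<in> A"
  defines "V \<equiv> map_prod (cmap c) (cmap c) ` ((cdom c \<times> cdom c) \<inter> D)"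
  shows "smooth_on V (\<lambda>(z, w). Blinfun (\<lambda>a. U (cinv c z) (cinv c w) (coordinate_vector A c (cinv c w) a) c))"
proof -
  let ?pc = "(cdom c \<times> cdom c, map_prod (cmap c) (cmap c))"
  let ?tc = "({((n, m), F). n \<in> cdom c \<and> m \<in> cdom c \<and> F \<in> tangent_linear_maps A m n},
      \<lambda>((n, m), F). ((cmap c n, cmap c m),
        Blinfun (\<lambda>a. chart_differential c (F (coordinate_vector A c m a)))))"
  let ?f = "\<lambda>(n, m). ((n, m), U n m)"
  let ?u = "\<lambda>p. Blinfun (\<lambda>a. U (cinv c (fst p)) (cinv c (snd p)) (coordinate_vector A c (cinv c (snd p)) a) c)"
  have tc: "topological_chart c"
    using assms smooth_structure_topological_chart by blast
  have "inj_on (cmap c) (cdom c)"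
    using cinv_cmap[OF tc] by (metis inj_on_inverseI)
  then have inj: "inj_on (map_prod (cmap c) (cmap c)) (cdom c \<times> cdom c)"
    by (simp add: map_prod_inj_on)
  have pc: "?pc \<in> product_atlas A"
    unfolding product_atlas_def using assms(3) by (intro image_eqI[of _ _ "(c, c)"]) auto
  have tca: "?tc \<in> tangent_hom_atlas A"
    unfolding tangent_hom_atlas_def using assms(3) by (intro image_eqI[of _ _ "(c, c)"]) auto
  have dom: "{p \<in> cdom ?pc \<inter> D. ?f p \<in> cdom ?tc} = (cdom c \<times> cdom c) \<inter> D"
    using assms(2) by (auto simp: is_parallelism_def)
  have sm: "smooth_map_on (product_atlas A) (tangent_hom_atlas A) D ?f"
    using assms(2) by (simp add: is_parallelism_def)
  have *: "open V" "smooth_on V (cmap ?tc \<circ> ?f \<circ> cinv ?pc)"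
    using smooth_map_onD[OF sm pc tca dom] unfolding V_def snd_conv by blast+
  have eq: "(cmap ?tc \<circ> ?f \<circ> cinv ?pc) p = (p, ?u p)" if p: "p \<in> V" for p
  proof -
    obtain m n where mn: "p = (cmap c m, cmap c n)" "m \<in> cdom c" "n \<in> cdom c"
      using p by (auto simp: V_def)
    have "cinv ?pc p = (m, n)"
      using inv_into_f_f[OF inj, of "(m, n)"] mn by (simp add: cinv_def)
    then show ?thesis
      using mn cinv_cmap[OF tc] by (simp add: chart_differential_def)
  qed
  have "smooth_on V (\<lambda>p. (p, ?u p))"
    by (rule iffD1[OF smooth_on_cong[OF *(1) eq] *(2)])
  from smooth_on_bounded_linear[OF *(1) bounded_linear_snd this] show ?thesis
    by (simp add: case_prod_beta')
qed

section \<open>Quantitative local estimates for gauges and metrics\<close>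

lemma local_logarithm_estimate:
  fixes A :: "('m::topological_space, 'e::fin_dim_inner) chart set"
  assumes "smooth_structure A" "diagonal_domain D" "is_logarithm A D \<psi>" "c \<in> A" "m0 \<in> cdom c"
  obtains r K where "r > 0" "K \<ge> 0"
    "\<And>m n. m \<in> cdom c \<Longrightarrow> n \<in> cdom c \<Longrightarrow> cmap c m \<in> ball (cmap c m0) r \<Longrightarrow>
       cmap c n \<in> ball (cmap c m0) r \<Longrightarrow> (m, n) \<in> D \<and>
       norm (\<psi> m n c - (cmap c n - cmap c m)) \<le> K * (norm (cmap c n - cmap c m))\<^sup>2"
proof -
  have tc: "topological_chart c"
    using assms smooth_structure_topological_chart by blast
  define V where "V = map_prod (cmap c) (cmap c) ` ((cdom c \<times> cdom c) \<inter> D)"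
  define \<Psi> where "\<Psi> = (\<lambda>(z, w). \<psi> (cinv c z) (cinv c w) c)"
  have V: "open V" "Ck_on 2 V \<Psi>"
    using logarithm_in_chart[OF assms(1,3,4)] by (auto simp: V_def \<Psi>_def smooth_on_def)
  have inV: "m \<in> cdom c \<and> n \<in> cdom c \<and> (m, n) \<in> D"
    if "(z, w) \<in> V" "m = cinv c z" "n = cinv c w" for m n z w
    using that cinv_cmap[OF tc] by (auto simp: V_def)
  have z0: "(cmap c m0, cmap c m0) \<in> V"
    using assms(2,5) by (auto simp: V_def diagonal_domain_def intro!: image_eqI[of _ _ "(m0, m0)"])
  have zero: "\<Psi> (z, z) = 0" for z
    using assms(3) by (simp add: \<Psi>_def is_logarithm_def)
  have diff: "frechet_derivative (\<lambda>w. \<Psi> (z, w)) (at z) a = a" if z: "(z, z) \<in> V" for z a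
  proof -
    obtain m where m: "m \<in> cdom c" "z = cmap c m"
      using z by (auto simp: V_def)
    \<comment> \<open>The defining property of the logarithm is an identity of tangent vectors; its
      \<open>c\<close> component on the coordinate vector of \<open>a\<close> is the required
      statement about the partial derivative.\<close>
    have "differential_in_chart c (\<psi> m) m (coordinate_vector A c m a) = coordinate_vector A c m a"
      using assms(3,4) m(1) coordinate_vector_in_tangent_space[OF assms(1,4) m(1)]
      unfolding is_logarithm_def by blast
    then have "differential_in_chart c (\<psi> m) m (coordinate_vector A c m a) c = a"
      using assms(1,4) m by (simp add: coordinate_vector_apply)
    then show ?thesis
      using coordinate_vector_apply[OF assms(1,4) m(1)] cinv_cmap[OF tc m(1)] m(2)
      by (simp add: differential_in_chart_def chart_differential_def \<Psi>_def)
  qed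
  obtain r K where rK: "r > 0" "K \<ge> 0"
    "\<And>z w. z \<in> ball (cmap c m0) r \<Longrightarrow> w \<in> ball (cmap c m0) r \<Longrightarrow> (z, w) \<in> V \<and>
       norm (\<Psi> (z, w) - (w - z)) \<le> K * (norm (w - z))\<^sup>2"
    using logarithm_second_order[OF V(2,1) z0 zero diff] by metis
  show ?thesis
  proof (rule that[OF rK(1,2)])
    fix m n assume "m \<in> cdom c" "n \<in> cdom c" "cmap c m \<in> ball (cmap c m0) r" "cmap c n \<in> ball (cmap c m0) r"
    then show "(m, n) \<in> D \<and> norm (\<psi> m n c - (cmap c n - cmap c m)) \<le> K * (norm (cmap c n - cmap c m))\<^sup>2"
      using rK(3)[of "cmap c m" "cmap c n"] inV[of "cmap c m" "cmap c n" m n] cinv_cmap[OF tc]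
      by (simp add: \<Psi>_def)
  qed
qed

text \<open>In coordinates \<open>U m n\<close> is compared with \<open>U m m\<close>, which is the
  identity; the representative is locally Lipschitz and the two arguments differ only in the second
  slot.\<close>

lemma local_parallelism_estimate:
  fixes A :: "('m::topological_space, 'e::fin_dim_inner) chart set"
  assumes "smooth_structure A" "diagonal_domain D" "is_parallelism A D U" "c \<in> A" "m0 \<in> cdom c"
    and "open (map_prod (cmap c) (cmap c) ` ((cdom c \<times> cdom c) \<inter> D))"
  obtains r K where "r > 0" "K \<ge> 0"
    "\<And>m n v. m \<in> cdom c \<Longrightarrow> n \<in> cdom c \<Longrightarrow> cmap c m \<in> ball (cmap c m0) r \<Longrightarrow>
       cmap c n \<in> ball (cmap c m0) r \<Longrightarrow> v \<in> tangent_space A n \<Longrightarrow>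
       norm (U m n v c - v c) \<le> K * norm (cmap c n - cmap c m) * norm (v c)"
proof -
  have tc: "topological_chart c"
    using assms smooth_structure_topological_chart by blast
  define V where "V = map_prod (cmap c) (cmap c) ` ((cdom c \<times> cdom c) \<inter> D)"
  define u where "u = (\<lambda>(z, w). Blinfun (\<lambda>a. U (cinv c z) (cinv c w) (coordinate_vector A c (cinv c w) a) c))"
  have u: "Ck_on 1 V u"
    using parallelism_in_chart[OF assms(1,3,4)] unfolding u_def V_def smooth_on_def by blast
  have V: "open V" using assms by (simp add: V_def)
  have inV: "m \<in> cdom c \<and> n \<in> cdom c \<and> (m, n) \<in> D"
    if "(z, w) \<in> V" "m = cinv c z" "n = cinv c w" for m n z w
    using that cinv_cmap[OF tc] by (auto simp: V_def)
  have z0: "(cmap c m0, cmap c m0) \<in> V"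
    using assms(2,5) by (auto simp: V_def diagonal_domain_def intro!: image_eqI[of _ _ "(m0, m0)"])
  obtain r K where rK: "r > 0" "K \<ge> 0" "ball (cmap c m0, cmap c m0) r \<subseteq> V"
    "\<And>p q. p \<in> ball (cmap c m0, cmap c m0) r \<Longrightarrow> q \<in> ball (cmap c m0, cmap c m0) r \<Longrightarrow>
      norm (u p - u q) \<le> K * norm (p - q)"
    using Ck_1_locally_Lipschitz[OF u V z0] by metis
  have in_ball: "(z, w) \<in> ball (z0, z0) r" if "z \<in> ball z0 (r / 2)" "w \<in> ball z0 (r / 2)" for z w z0 :: 'e
    using that sqrt_sum_squares_le_sum_abs[of "dist z0 z" "dist z0 w"] by (simp add: dist_Pair_Pair)
  have u_apply: "blinfun_apply (u (cmap c m, cmap c n)) (v c) = U m n v c"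
    if "m \<in> cdom c" "n \<in> cdom c" "(m, n) \<in> D" "v \<in> tangent_space A n" for m n v
  proof -
    have "U m n \<in> tangent_linear_maps A n m"
      using assms(3) that by (auto simp: is_parallelism_def)
    then show ?thesis
      using tangent_linear_map_in_chart[OF assms(1,4) that(2)] that assms(4)
      by (simp add: u_def cinv_cmap[OF tc] bounded_linear_Blinfun_apply coordinate_vector_of_tangent)
  qed
  show ?thesis
  proof (rule that[of "r / 2" K])
    show "r / 2 > 0" "K \<ge> 0" using rK by auto
    fix m n v assume m: "m \<in> cdom c" "cmap c m \<in> ball (cmap c m0) (r / 2)"
      and n: "n \<in> cdom c" "cmap c n \<in> ball (cmap c m0) (r / 2)" and v: "v \<in> tangent_space A n"
    \<comment> \<open>The vector at \<open>m\<close> with the same coordinates as \<open>v\<close>.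
      Since \<open>U m m\<close> fixes it, \<open>v c\<close> can be written as the representative
      at the diagonal point applied to \<open>v c\<close>.\<close>
    let ?w = "coordinate_vector A c m (v c)"
    have "(cmap c m, cmap c n) \<in> V"
      using in_ball[OF m(2) n(2)] rK(3) by blast
    then have mn: "(m, n) \<in> D"
      using inV m n cinv_cmap[OF tc] by force
    have mm: "(m, m) \<in> D" using assms(2) by (simp add: diagonal_domain_def)
    have w: "?w \<in> tangent_space A m" "?w c = v c"
      using coordinate_vector_in_tangent_space[OF assms(1,4) m(1)] coordinate_vector_apply[OF assms(1,4) m(1)]
      by auto
    have "U m m ?w = ?w"
      using assms(3) w by (simp add: is_parallelism_def)
    then have "U m n v c - v c = blinfun_apply (u (cmap c m, cmap c n) - u (cmap c m, cmap c m)) (v c)"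
      using u_apply[OF m(1) n(1) mn v] u_apply[OF m(1) m(1) mm w(1)] w(2)
      by (simp add: blinfun.diff_left)
    also have "norm \<dots> \<le> norm (u (cmap c m, cmap c n) - u (cmap c m, cmap c m)) * norm (v c)"
      by (rule norm_blinfun)
    also have "\<dots> \<le> K * norm ((cmap c m, cmap c n) - (cmap c m, cmap c m)) * norm (v c)"
      using in_ball m n by (intro mult_right_mono rK) auto
    finally show "norm (U m n v c - v c) \<le> K * norm (cmap c n - cmap c m) * norm (v c)"
      by (simp add: norm_prod_def)
  qed
qed

lemma local_metric_estimate:
  fixes A :: "('m::topological_space, 'e::fin_dim_inner) chart set"
  assumes "smooth_structure A" "riemannian_metric A g" "c \<in> A" "m0 \<in> cdom c"
  obtains r K where "r > 0" "K > 0"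
    "\<And>m v. m \<in> cdom c \<Longrightarrow> cmap c m \<in> ball (cmap c m0) r \<Longrightarrow> v \<in> tangent_space A m \<Longrightarrow>
       norm (v c) \<le> K * metric_norm g m v \<and> metric_norm g m v \<le> K * norm (v c)"
proof -
  have tc: "topological_chart c"
    using assms smooth_structure_topological_chart by blast
  define S where "S = cmap c ` cdom c"
  define G where "G z a b = g (cinv c z) (coordinate_vector A c (cinv c z) a)
                          (coordinate_vector A c (cinv c z) b)" for z a b
  have S: "open S" "cmap c m0 \<in> S"
    using tc assms by (auto simp: S_def topological_chart_def)
  have in_dom: "cinv c z \<in> cdom c" if "z \<in> S" for z
    using that cinv_cmap[OF tc] by (auto simp: S_def)
  have cv: "coordinate_vector A c (cinv c z) a \<in> tangent_space A (cinv c z)" if "z \<in> S" for z a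
    using coordinate_vector_in_tangent_space[OF assms(1,3) in_dom[OF that]] .
  have sym: "G z a b = G z b a" if "z \<in> S" for z a b
    using assms(2) cv[OF that] by (simp add: riemannian_metric_def G_def)
  have lin2: "linear (\<lambda>a. G z a b)" if "z \<in> S" for z b
    using assms(2) cv[OF that]
    by (intro linearI) (simp_all add: riemannian_metric_def G_def coordinate_vector_linear[OF assms(1,3) in_dom[OF that]])
  have lin1: "linear (G z a)" if "z \<in> S" for z a
    using lin2[OF that] sym[OF that] by presburger
  have pos: "G z a a > 0" if "z \<in> S" "a \<noteq> 0" for z a
  proof -
    have "coordinate_vector A c (cinv c z) a \<noteq> 0"
      using coordinate_vector_apply[OF assms(1,3) in_dom[OF that(1)], of a] that(2) by auto
    then show ?thesis
      using assms(2) cv[OF that(1), of a] unfolding riemannian_metric_def G_def by blast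
  qed
  have cont: "continuous_on S (\<lambda>z. G z a b)" for a b
    using assms(2,3) unfolding riemannian_metric_def G_def S_def
    by (intro smooth_on_imp_continuous_on) blast
  obtain r k K where r: "r > 0" "k > 0" "K > 0" "ball (cmap c m0) r \<subseteq> S"
    "\<And>z a. z \<in> ball (cmap c m0) r \<Longrightarrow> k * (norm a)\<^sup>2 \<le> G z a a \<and> G z a a \<le> K * (norm a)\<^sup>2"
    using inner_products_locally_equivalent[OF S lin1 lin2 pos cont] by metis
  show ?thesis
  \<comment> \<open>The bounds concern squares; after taking roots, the lower one gives
    \<open>1 / sqrt k\<close> and the upper one \<open>sqrt K\<close>.\<close>
  proof (rule that[of r "max (sqrt K) (1 / sqrt k)"])
    show "r > 0" "max (sqrt K) (1 / sqrt k) > 0" using r(1-3) by (auto simp: less_max_iff_disj)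
    fix m v assume m: "m \<in> cdom c" "cmap c m \<in> ball (cmap c m0) r" and v: "v \<in> tangent_space A m"
    have "G (cmap c m) (v c) (v c) = g m v v"
      using m v assms(3) by (simp add: G_def cinv_cmap[OF tc] coordinate_vector_of_tangent)
    then have "k * (norm (v c))\<^sup>2 \<le> g m v v" "g m v v \<le> K * (norm (v c))\<^sup>2"
      using r(5)[OF m(2), of "v c"] by auto
    then have "sqrt (k * (norm (v c))\<^sup>2) \<le> metric_norm g m v" "metric_norm g m v \<le> sqrt (K * (norm (v c))\<^sup>2)"
      unfolding metric_norm_def by (auto intro: real_sqrt_le_mono)
    then have b: "sqrt k * norm (v c) \<le> metric_norm g m v" "metric_norm g m v \<le> sqrt K * norm (v c)"
      by (simp_all add: real_sqrt_mult)
    then have "norm (v c) \<le> 1 / sqrt k * metric_norm g m v"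
      using r(2) by (simp add: field_simps)
    moreover have "metric_norm g m v \<ge> 0"
      using b(1) r(2) by (meson mult_nonneg_nonneg norm_ge_zero order_trans real_sqrt_ge_zero less_imp_le)
    then have "1 / sqrt k * metric_norm g m v \<le> max (sqrt K) (1 / sqrt k) * metric_norm g m v"
      by (intro mult_right_mono) auto
    moreover have "sqrt K * norm (v c) \<le> max (sqrt K) (1 / sqrt k) * norm (v c)"
      by (intro mult_right_mono) auto
    ultimately show "norm (v c) \<le> max (sqrt K) (1 / sqrt k) * metric_norm g m v \<and>
        metric_norm g m v \<le> max (sqrt K) (1 / sqrt k) * norm (v c)"
      using b(2) by linarith
  qed
qed

text \<open>One neighbourhood and one constant for all three estimates. The additional bound by
  \<open>1 / 2\<close> is the smallness that later absorbs the quadratic error of the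
  logarithm.\<close>

lemma local_gauge_coordinates:
  fixes A :: "('m::topological_space, 'e::fin_dim_inner) chart set"
  assumes "smooth_structure A" "is_gauge A D \<psi> U" "riemannian_metric A g" "c \<in> A" "m0 \<in> cdom c"
  obtains N K where "open N" "m0 \<in> N" "N \<subseteq> cdom c" "K > 0"
    "\<And>m n. m \<in> N \<Longrightarrow> n \<in> N \<Longrightarrow> (m, n) \<in> D"
    "\<And>m n. m \<in> N \<Longrightarrow> n \<in> N \<Longrightarrow> K * norm (cmap c n - cmap c m) \<le> 1 / 2"
    "\<And>m n. m \<in> N \<Longrightarrow> n \<in> N \<Longrightarrow>
      norm (\<psi> m n c - (cmap c n - cmap c m)) \<le> K * (norm (cmap c n - cmap c m))\<^sup>2"
    "\<And>m n v. m \<in> N \<Longrightarrow> n \<in> N \<Longrightarrow> v \<in> tangent_space A n \<Longrightarrow>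
      norm (U m n v c - v c) \<le> K * norm (cmap c n - cmap c m) * norm (v c)"
    "\<And>m v. m \<in> N \<Longrightarrow> v \<in> tangent_space A m \<Longrightarrow> norm (v c) \<le> K * metric_norm g m v"
    "\<And>m v. m \<in> N \<Longrightarrow> v \<in> tangent_space A m \<Longrightarrow> metric_norm g m v \<le> K * norm (v c)"
proof -
  have gauge: "diagonal_domain D" "is_logarithm A D \<psi>" "is_parallelism A D U"
    using assms(2) by (auto simp: is_gauge_def)
  have tc: "topological_chart c"
    using assms smooth_structure_topological_chart by blast
  obtain r1 K1 where 1: "r1 > 0" "K1 \<ge> 0"
    "\<And>m n. m \<in> cdom c \<Longrightarrow> n \<in> cdom c \<Longrightarrow> cmap c m \<in> ball (cmap c m0) r1 \<Longrightarrow>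
       cmap c n \<in> ball (cmap c m0) r1 \<Longrightarrow> (m, n) \<in> D \<and>
       norm (\<psi> m n c - (cmap c n - cmap c m)) \<le> K1 * (norm (cmap c n - cmap c m))\<^sup>2"
    using local_logarithm_estimate[OF assms(1) gauge(1,2) assms(4,5)] by metis
  obtain r2 K2 where 2: "r2 > 0" "K2 \<ge> 0"
    "\<And>m n v. m \<in> cdom c \<Longrightarrow> n \<in> cdom c \<Longrightarrow> cmap c m \<in> ball (cmap c m0) r2 \<Longrightarrow>
       cmap c n \<in> ball (cmap c m0) r2 \<Longrightarrow> v \<in> tangent_space A n \<Longrightarrow>
       norm (U m n v c - v c) \<le> K2 * norm (cmap c n - cmap c m) * norm (v c)"
    using local_parallelism_estimate[OF assms(1) gauge(1,3) assms(4,5)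
        logarithm_in_chart(1)[OF assms(1) gauge(2) assms(4)]] by metis
  obtain r3 K3 where 3: "r3 > 0" "K3 > 0"
    "\<And>m v. m \<in> cdom c \<Longrightarrow> cmap c m \<in> ball (cmap c m0) r3 \<Longrightarrow> v \<in> tangent_space A m \<Longrightarrow>
       norm (v c) \<le> K3 * metric_norm g m v \<and> metric_norm g m v \<le> K3 * norm (v c)"
    using local_metric_estimate[OF assms(1,3-5)] by metis
  define K where "K = K1 + K2 + K3"
  \<comment> \<open>Two points of the ball are less than \<open>2 * r \<le> 1 / (2 * K)\<close>
    apart, which yields the bound \<open>1 / 2\<close>.\<close>
  define r where "r = min (min r1 r2) (min r3 (1 / (4 * K)))"
  define N where "N = cdom c \<inter> cmap c -` ball (cmap c m0) r"
  have K: "K > 0" "K1 \<le> K" "K2 \<le> K" "K3 \<le> K" using 1 2 3 by (auto simp: K_def)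
  have r: "r > 0" "r \<le> r1" "r \<le> r2" "r \<le> r3" "r \<le> 1 / (4 * K)"
    using 1 2 3 K by (auto simp: r_def)
  have N: "m \<in> cdom c" "cmap c m \<in> ball (cmap c m0) r" "cmap c m \<in> ball (cmap c m0) r1"
      "cmap c m \<in> ball (cmap c m0) r2" "cmap c m \<in> ball (cmap c m0) r3" if "m \<in> N" for m
    using that r by (auto simp: N_def)
  have "continuous_on (cdom c) (cmap c)" "open (cdom c)"
    using tc by (auto simp: topological_chart_def homeomorphism_def)
  then have "open N"
    unfolding N_def by (simp add: continuous_open_preimage)
  moreover have "m0 \<in> N" "N \<subseteq> cdom c" using assms r by (auto simp: N_def)
  moreover have "K * norm (cmap c n - cmap c m) \<le> 1 / 2" if "m \<in> N" "n \<in> N" for m n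
  proof -
    have "norm (cmap c n - cmap c m) < r + r"
      using N(2)[OF that(1)] N(2)[OF that(2)] dist_triangle_less_add[of "cmap c n" "cmap c m0" r "cmap c m" r]
      by (simp add: dist_norm norm_minus_commute)
    also have "\<dots> \<le> 1 / (2 * K)" using r(5) by (simp add: field_simps)
    finally show ?thesis using K by (simp add: field_simps)
  qed
  moreover have "norm (\<psi> m n c - (cmap c n - cmap c m)) \<le> K * (norm (cmap c n - cmap c m))\<^sup>2"
    if "m \<in> N" "n \<in> N" for m n
    using 1(3)[of m n] that N K(2) by (meson mult_right_mono order_trans zero_le_power2)
  moreover have "(m, n) \<in> D" if "m \<in> N" "n \<in> N" for m n
    using 1(3)[of m n] that N by blast
  moreover have "norm (U m n v c - v c) \<le> K * norm (cmap c n - cmap c m) * norm (v c)"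
    if "m \<in> N" "n \<in> N" "v \<in> tangent_space A n" for m n v
    using 2(3)[of m n v] that N K(3) by (meson mult_right_mono order_trans norm_ge_zero)
  moreover have "norm (v c) \<le> K * metric_norm g m v" "metric_norm g m v \<le> K * norm (v c)"
    if "m \<in> N" "v \<in> tangent_space A m" for m v
  proof -
    have *: "norm (v c) \<le> K3 * metric_norm g m v" "metric_norm g m v \<le> K3 * norm (v c)"
      using 3(3)[of m v] that N by auto
    then have "metric_norm g m v \<ge> 0"
      using 3(2) by (smt (verit) norm_ge_zero zero_le_mult_iff)
    then show "norm (v c) \<le> K * metric_norm g m v" "metric_norm g m v \<le> K * norm (v c)"
      using * K(4) by (meson mult_right_mono order_trans norm_ge_zero)+
  qed
  ultimately show ?thesis using K(1) by (intro that[of N K])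
qed

section \<open>Rough path estimates\<close>

text \<open>Stated for a single pair of times with an explicit constant, so that it can be treated
  as a predicate monotone in \<open>C\<close> when local estimates are glued.\<close>

definition chart_estimate :: "('m, 'e::real_normed_vector) chart \<Rightarrow> real \<Rightarrow>
    (real \<Rightarrow> real \<Rightarrow> real) \<Rightarrow> (real \<Rightarrow> 'w::real_normed_vector) \<Rightarrow>
    (real \<Rightarrow> 'm) \<Rightarrow> (real \<Rightarrow> 'w \<Rightarrow> ('m, 'e) tvec) \<Rightarrow> real \<Rightarrow> real \<Rightarrow> real \<Rightarrow> bool" where
  "chart_estimate c p \<omega> x y y' C s t \<longleftrightarrow>
     norm (cmap c (y t) - cmap c (y s) - y' s (x t - x s) c) \<le> C * \<omega> s t powr (2 / p) \<and>
     onorm (\<lambda>w. y' t w c - y' s w c) \<le> C * \<omega> s t powr (1 / p)"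

text \<open>The condition \<open>(y s, y t) \<in> D\<close> is kept apart: it follows from closeness
  in time, not from the inequalities.\<close>

definition gauge_estimate :: "('m \<Rightarrow> 'm \<Rightarrow> ('m, 'e::real_normed_vector) tvec) \<Rightarrow>
    ('m \<Rightarrow> 'm \<Rightarrow> ('m, 'e) tvec \<Rightarrow> ('m, 'e) tvec) \<Rightarrow>
    ('m \<Rightarrow> ('m, 'e) tvec \<Rightarrow> ('m, 'e) tvec \<Rightarrow> real) \<Rightarrow> real \<Rightarrow>
    (real \<Rightarrow> real \<Rightarrow> real) \<Rightarrow> (real \<Rightarrow> 'w::real_normed_vector) \<Rightarrow>
    (real \<Rightarrow> 'm) \<Rightarrow> (real \<Rightarrow> 'w \<Rightarrow> ('m, 'e) tvec) \<Rightarrow> real \<Rightarrow> real \<Rightarrow> real \<Rightarrow> bool" where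
  "gauge_estimate \<psi> U g p \<omega> x y y' C s t \<longleftrightarrow>
     metric_norm g (y s) (\<psi> (y s) (y t) - y' s (x t - x s)) \<le> C * \<omega> s t powr (2 / p) \<and>
     metric_onorm g (y s) (\<lambda>w. U (y s) (y t) (y' t w) - y' s w) \<le> C * \<omega> s t powr (1 / p)"

lemma chart_estimate_mono:
  "chart_estimate c p \<omega> x y y' C s t \<Longrightarrow> C \<le> C' \<Longrightarrow> chart_estimate c p \<omega> x y y' C' s t"
  unfolding chart_estimate_def by (meson mult_right_mono order_trans powr_ge_zero)

lemma gauge_estimate_mono:
  "gauge_estimate \<psi> U g p \<omega> x y y' C s t \<Longrightarrow> C \<le> C' \<Longrightarrow> gauge_estimate \<psi> U g p \<omega> x y y' C' s t"
  unfolding gauge_estimate_def by (meson mult_right_mono order_trans powr_ge_zero)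

lemma control_mono:
  assumes "is_control T \<omega>" "0 \<le> s" "s \<le> u" "u \<le> v" "v \<le> t" "t \<le> T"
  shows "0 \<le> \<omega> u v" "\<omega> u v \<le> \<omega> s t"
proof -
  have nn: "0 \<le> \<omega> a b" if "0 \<le> a" "a \<le> b" "b \<le> T" for a b
    using assms(1) that by (auto simp: is_control_def simplex2_def)
  have "\<omega> s u + \<omega> u t \<le> \<omega> s t" "\<omega> u v + \<omega> v t \<le> \<omega> u t"
    using assms by (auto simp: is_control_def)
  then show "0 \<le> \<omega> u v" "\<omega> u v \<le> \<omega> s t"
    using nn[of s u] nn[of v t] nn[of u v] assms by auto
qed

lemma control_powr_mono:
  assumes "is_control T \<omega>" "0 \<le> s" "s \<le> u" "u \<le> v" "v \<le> t" "t \<le> T" "0 \<le> a"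
  shows "\<omega> u v powr a \<le> \<omega> s t powr a"
  using control_mono[OF assms(1-6)] assms(7) by (intro powr_mono2)

text \<open>With \<open>h = \<omega> s t powr (1 / p)\<close> the two orders of smallness become
  \<open>h\<close> and its square, and the remaining algebra no longer sees
  \<open>p\<close>.\<close>

lemma powr_two_div: "(r::real) powr (2 / p) = (r powr (1 / p))\<^sup>2"
  by (simp add: power2_eq_square flip: powr_add)

lemma linear_in_chart:
  assumes "L \<in> linear_maps_into A m"
  shows "linear (\<lambda>w. L w c)"
  using assms by (auto simp: linear_maps_into_def linear_iff scaleR_fun_def)

lemma metric_onorm_le:
  assumes "\<And>w. L w \<in> tangent_space A m" "0 \<le> K" "0 \<le> b"
    and "\<And>v. v \<in> tangent_space A m \<Longrightarrow> metric_norm g m v \<le> K * norm (v c)"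
    and "\<And>w. norm (L w c) \<le> b * norm w"
  shows "metric_onorm g m L \<le> K * b"
  unfolding metric_onorm_def
proof (rule cSUP_least)
  fix w :: 'a assume "w \<in> cball 0 1"
  then have "b * norm w \<le> b" using assms(3) by (simp add: mult_left_le)
  then have "norm (L w c) \<le> b" using assms(5)[of w] by linarith
  then show "metric_norm g m (L w) \<le> K * b"
    using assms(4)[OF assms(1), of w] assms(2) by (meson mult_left_mono order_trans)
qed simp

text \<open>By homogeneity it suffices to test on \<open>sgn w\<close>. A real supremum bounds its
  members only when the set is bounded above, and that bound is taken from the operator norm in the
  chart.\<close>

lemma norm_le_metric_onorm:
  assumes "\<And>w. L w \<in> tangent_space A m" "0 \<le> K" "bounded_linear (\<lambda>w. L w c)"
    and "\<And>v. v \<in> tangent_space A m \<Longrightarrow> metric_norm g m v \<le> K * norm (v c)"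
    and "\<And>v. v \<in> tangent_space A m \<Longrightarrow> norm (v c) \<le> K * metric_norm g m v"
  shows "norm (L w c) \<le> K * metric_onorm g m L * norm w"
proof (cases "w = 0")
  case True
  then show ?thesis using linear_0[OF bounded_linear.linear[OF assms(3)]] by simp
next
  case False
  have "metric_norm g m (L u) \<le> K * onorm (\<lambda>w. L w c)" if "u \<in> cball 0 1" for u
  proof -
    have "norm (L u c) \<le> onorm (\<lambda>w. L w c) * norm u"
      by (rule onorm[OF assms(3)])
    also have "\<dots> \<le> onorm (\<lambda>w. L w c)"
      using that onorm_pos_le[OF assms(3)] by (simp add: mult_left_le)
    finally show ?thesis
      using assms(4)[OF assms(1), of u] assms(2) by (meson mult_left_mono order_trans)
  qed
  then have bdd: "bdd_above ((\<lambda>u. metric_norm g m (L u)) ` cball 0 1)"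
    by (intro bdd_aboveI2)
  have "norm (L (sgn w) c) \<le> K * metric_norm g m (L (sgn w))"
    by (intro assms)
  also have "\<dots> \<le> K * metric_onorm g m L"
    unfolding metric_onorm_def using False
    by (intro mult_left_mono cSUP_upper bdd assms(2)) (simp add: norm_sgn)
  finally have "norm w * norm (L (sgn w) c) \<le> norm w * (K * metric_onorm g m L)"
    by (intro mult_left_mono) auto
  moreover have "L (norm w *\<^sub>R sgn w) c = norm w *\<^sub>R L (sgn w) c"
    using linear_scale[OF bounded_linear.linear[OF assms(3)]] .
  ultimately show ?thesis
    using False by (simp add: sgn_div_norm mult_ac)
qed

section \<open>Comparison of chart and gauge increments near one time\<close>

text \<open>Here \<open>a\<close> is the chart increment, \<open>l\<close> the logarithm,
  \<open>e\<close> the first order term and \<open>h\<close> the root of the control. The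
  disjunction lets the same computation serve both directions: either remainder bound gives
  \<open>norm a \<le> E * h\<close>, and then the two remainders differ by at most
  \<open>K * E\<^sup>2 * h\<^sup>2\<close>. In \<open>E\<close>, the sum \<open>B + C * H\<close>
  bounds the first order term plus the remainder, and the factor \<open>2\<close> pays for the
  absorption.\<close>

lemma increment_estimates:
  fixes a l e :: "'e::real_normed_vector"
  assumes "norm (l - a) \<le> K * (norm a)\<^sup>2" "K * norm a \<le> 1 / 2" "0 < K"
    and "norm e \<le> B * h" "0 \<le> h" "h \<le> H" "0 \<le> B" "0 \<le> C"
    and "norm (a - e) \<le> C * h\<^sup>2 \<or> norm (l - e) \<le> C * h\<^sup>2"
  defines "E \<equiv> 2 * (B + C * H)"
  shows "norm a \<le> E * h" "norm (l - e) \<le> (C + K * E\<^sup>2) * h\<^sup>2" "norm (a - e) \<le> (C + K * E\<^sup>2) * h\<^sup>2"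
proof -
  \<comment> \<open>One of the two factors \<open>h\<close> is given up for its bound
    \<open>H\<close>, so that everything is linear in \<open>h\<close>.\<close>
  have "C * h\<^sup>2 \<le> C * H * h"
    using assms by (simp add: power2_eq_square mult_mono mult.assoc)
  then have Ch: "B * h + C * h\<^sup>2 \<le> E / 2 * h" by (simp add: E_def algebra_simps)
  \<comment> \<open>The absorption: in the second case below it gives
    \<open>norm a \<le> 2 * norm l\<close>.\<close>
  have la: "norm (l - a) \<le> norm a / 2"
  proof -
    have "K * norm a * norm a \<le> 1 / 2 * norm a"
      using assms(2) by (intro mult_right_mono) auto
    then show ?thesis using assms(1) by (simp add: power2_eq_square mult.assoc)
  qed
  have E0: "0 \<le> E * h" using assms by (simp add: E_def)
  show a: "norm a \<le> E * h"
    using assms(9)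
  proof
    assume "norm (a - e) \<le> C * h\<^sup>2"
    then have "norm a \<le> E / 2 * h"
      using Ch assms(4) norm_triangle_sub[of a e] by linarith
    then show ?thesis using E0 by simp
  next
    assume "norm (l - e) \<le> C * h\<^sup>2"
    then have "norm l \<le> E / 2 * h"
      using Ch assms(4) norm_triangle_sub[of l e] by linarith
    moreover have "norm a \<le> norm l + norm (l - a)"
      using norm_triangle_sub[of a l] by (simp add: norm_minus_commute)
    ultimately show ?thesis using la by simp
  qed
  have "norm (l - a) \<le> K * (E * h)\<^sup>2"
    using assms(1,3) a by (smt (verit) mult_left_mono norm_ge_zero power_mono)
  then have l: "norm (l - a) \<le> K * E\<^sup>2 * h\<^sup>2"
    by (simp add: power_mult_distrib)
  have "0 \<le> K * E\<^sup>2 * h\<^sup>2" using assms(3) by simp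
  moreover have "norm (l - e) \<le> norm (l - a) + norm (a - e)" "norm (a - e) \<le> norm (l - a) + norm (l - e)"
    using norm_triangle_ineq[of "l - a" "a - e"] norm_triangle_ineq[of "a - l" "l - e"]
    by (simp_all add: norm_minus_commute)
  ultimately show "norm (l - e) \<le> (C + K * E\<^sup>2) * h\<^sup>2" "norm (a - e) \<le> (C + K * E\<^sup>2) * h\<^sup>2"
    using l assms(9) by (auto simp: distrib_right)
qed

text \<open>Continuity into the bundle means that the operator of \<open>y'\<close> in the chart
  varies continuously, so near \<open>t0\<close> its norm exceeds the value at \<open>t0\<close> by
  at most \<open>1\<close>.\<close>

lemma path_locally_bounded:
  fixes y' :: "real \<Rightarrow> 'w::euclidean_space \<Rightarrow> ('m::topological_space, 'e::fin_dim_inner) tvec"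
  assumes "continuous_on {0..T} y" "\<forall>s\<in>{0..T}. y' s \<in> linear_maps_into A (y s)"
    and "continuous_map_into (linear_maps_atlas A) {0..T} (\<lambda>s. (y s, y' s))"
    and "c \<in> A" "open N" "N \<subseteq> cdom c" "t0 \<in> {0..T}" "y t0 \<in> N"
  obtains e B where "e > 0" "B \<ge> 0"
    "\<And>s. s \<in> {0..T} \<Longrightarrow> \<bar>s - t0\<bar> < e \<Longrightarrow> y s \<in> N"
    "\<And>s w. s \<in> {0..T} \<Longrightarrow> \<bar>s - t0\<bar> < e \<Longrightarrow> norm (y' s w c) \<le> B * norm w"
proof -
  let ?lc = "({(m, L). m \<in> cdom c \<and> L \<in> linear_maps_into A m},
      \<lambda>(m, L). (cmap c m, Blinfun (chart_differential c \<circ> L)))"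
  define S where "S = {s \<in> {0..T}. y s \<in> cdom c}"
  define Y where "Y s = Blinfun (chart_differential c \<circ> y' s)" for s
  have lc: "?lc \<in> linear_maps_atlas A"
    unfolding linear_maps_atlas_def using assms(4) by (intro image_eqI[of _ _ c]) auto
  have S: "{s \<in> {0..T}. (y s, y' s) \<in> cdom ?lc} = S"
    using assms(2) by (auto simp: S_def)
  have "continuous_on {s \<in> {0..T}. (y s, y' s) \<in> cdom ?lc} (cmap ?lc \<circ> (\<lambda>s. (y s, y' s)))"
    using assms(3) lc unfolding continuous_map_into_def by blast
  then have "continuous_on S (cmap ?lc \<circ> (\<lambda>s. (y s, y' s)))"
    unfolding S .
  then have "continuous_on S (\<lambda>s. snd ((cmap ?lc \<circ> (\<lambda>s. (y s, y' s))) s))"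
    by (rule continuous_on_snd)
  then have "continuous_on S Y"
    by (simp add: Y_def [abs_def])
  then have "continuous_on S (\<lambda>s. norm (Y s))"
    by (intro continuous_intros)
  moreover have "t0 \<in> S" using assms by (auto simp: S_def)
  ultimately obtain d where d: "d > 0" "\<And>s. s \<in> S \<Longrightarrow> dist s t0 < d \<Longrightarrow> dist (norm (Y s)) (norm (Y t0)) < 1"
    unfolding continuous_on_iff by (metis zero_less_one)
  obtain O' where "open O'" "t0 \<in> O'" "\<And>s. s \<in> {0..T} \<Longrightarrow> s \<in> O' \<Longrightarrow> y s \<in> N"
    using assms(1,5,7,8) unfolding continuous_on_topological by metis
  then obtain d' where d': "d' > 0" "\<And>s. s \<in> {0..T} \<Longrightarrow> dist s t0 < d' \<Longrightarrow> y s \<in> N"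
    unfolding open_dist by metis
  show ?thesis
  proof
    show "min d d' > 0" "norm (Y t0) + 1 \<ge> 0" using d d' by auto
    fix s assume s: "s \<in> {0..T}" "\<bar>s - t0\<bar> < min d d'"
    then show sN: "y s \<in> N" using d' by (simp add: dist_real_def)
    fix w
    have "s \<in> S" using sN s assms(6) by (auto simp: S_def)
    then have "norm (Y s) \<le> norm (Y t0) + 1"
      using d(2)[of s] s by (simp add: dist_real_def)
    moreover have "bounded_linear (chart_differential c \<circ> y' s)"
      using linear_in_chart[of "y' s" A "y s" c] assms(2) s
      by (simp add: linear_conv_bounded_linear comp_def chart_differential_def)
    then have "norm (y' s w c) \<le> norm (Y s) * norm w"
      using norm_blinfun[of "Y s" w] by (simp add: Y_def bounded_linear_Blinfun_apply chart_differential_def)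
    ultimately show "norm (y' s w c) \<le> (norm (Y t0) + 1) * norm w"
      by (meson mult_right_mono norm_ge_zero order_trans)
  qed
qed

text \<open>The radius \<open>e\<close> comes before \<open>C\<close> and does not depend on it;
  only \<open>C'\<close> does. This order is needed because the constant of a chart estimate becomes
  available only after an interval inside the radius has been chosen.\<close>

lemma local_estimates_equivalent:
  fixes A :: "('m::topological_space, 'e::fin_dim_inner) chart set"
    and y' :: "real \<Rightarrow> 'w::euclidean_space \<Rightarrow> ('m, 'e) tvec"
  assumes A: "smooth_structure A" "is_gauge A D \<psi> U" "riemannian_metric A g"
    and y: "continuous_on {0..T} y" "\<forall>s\<in>{0..T}. y' s \<in> linear_maps_into A (y s)"
      "continuous_map_into (linear_maps_atlas A) {0..T} (\<lambda>s. (y s, y' s))"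
    and \<omega>: "is_control T \<omega>" "0 < p"
    and x: "\<forall>s t. 0 \<le> s \<and> s \<le> t \<and> t \<le> T \<longrightarrow> norm (x t - x s) \<le> \<omega> s t powr (1 / p)"
    and c: "c \<in> A" "t0 \<in> {0..T}" "y t0 \<in> cdom c"
  shows "\<exists>e>0.
    (\<forall>s\<in>{0..T}. \<bar>s - t0\<bar> < e \<longrightarrow> y s \<in> cdom c) \<and>
    (\<forall>s\<in>{0..T}. \<forall>t\<in>{0..T}. \<bar>s - t0\<bar> < e \<and> \<bar>t - t0\<bar> < e \<longrightarrow> (y s, y t) \<in> D) \<and>
    (\<forall>C\<ge>0. \<exists>C'\<ge>0. \<forall>s t. 0 \<le> s \<and> s \<le> t \<and> t \<le> T \<and> \<bar>s - t0\<bar> < e \<and> \<bar>t - t0\<bar> < e \<longrightarrow>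
       chart_estimate c p \<omega> x y y' C s t \<longrightarrow> gauge_estimate \<psi> U g p \<omega> x y y' C' s t) \<and>
    (\<forall>C\<ge>0. \<exists>C'\<ge>0. \<forall>s t. 0 \<le> s \<and> s \<le> t \<and> t \<le> T \<and> \<bar>s - t0\<bar> < e \<and> \<bar>t - t0\<bar> < e \<longrightarrow>
       gauge_estimate \<psi> U g p \<omega> x y y' C s t \<longrightarrow> chart_estimate c p \<omega> x y y' C' s t)"
proof (rule local_gauge_coordinates[OF A c(1,3)])
  fix N K assume N: "open N" "y t0 \<in> N" "N \<subseteq> cdom c" and K: "K > 0"
    and ND: "\<And>m n. m \<in> N \<Longrightarrow> n \<in> N \<Longrightarrow> (m, n) \<in> D"
    and small: "\<And>m n. m \<in> N \<Longrightarrow> n \<in> N \<Longrightarrow> K * norm (cmap c n - cmap c m) \<le> 1 / 2"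
    and log: "\<And>m n. m \<in> N \<Longrightarrow> n \<in> N \<Longrightarrow>
      norm (\<psi> m n c - (cmap c n - cmap c m)) \<le> K * (norm (cmap c n - cmap c m))\<^sup>2"
    and par: "\<And>m n v. m \<in> N \<Longrightarrow> n \<in> N \<Longrightarrow> v \<in> tangent_space A n \<Longrightarrow>
      norm (U m n v c - v c) \<le> K * norm (cmap c n - cmap c m) * norm (v c)"
    and met1: "\<And>m v. m \<in> N \<Longrightarrow> v \<in> tangent_space A m \<Longrightarrow> norm (v c) \<le> K * metric_norm g m v"
    and met2: "\<And>m v. m \<in> N \<Longrightarrow> v \<in> tangent_space A m \<Longrightarrow> metric_norm g m v \<le> K * norm (v c)"
  obtain e B where e: "e > 0" "B \<ge> 0"
    "\<And>s. s \<in> {0..T} \<Longrightarrow> \<bar>s - t0\<bar> < e \<Longrightarrow> y s \<in> N"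
    "\<And>s w. s \<in> {0..T} \<Longrightarrow> \<bar>s - t0\<bar> < e \<Longrightarrow> norm (y' s w c) \<le> B * norm w"
    using path_locally_bounded[OF y c(1) N(1,3) c(2) N(2)] by metis
  \<comment> \<open>A common bound for all \<open>h\<close>, by monotonicity of the control.\<close>
  define H where "H = \<omega> 0 T powr (1 / p)"
  have tangent: "y' s w \<in> tangent_space A (y s)" if "s \<in> {0..T}" for s w
    using y(2) that unfolding linear_maps_into_def by blast
  have y'_lin: "linear (\<lambda>w. y' s w c)" if "s \<in> {0..T}" for s
    using linear_in_chart[of "y' s" A "y s" c] y(2) that by auto
  have facts: "y s \<in> N" "y t \<in> N" "s \<in> {0..T}" "t \<in> {0..T}"
      "norm (y' s (x t - x s) c) \<le> B * \<omega> s t powr (1 / p)"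
      "\<omega> s t powr (1 / p) \<le> H"
      "\<And>w. norm (y' t w c) \<le> B * norm w"
      "\<psi> (y s) (y t) - y' s (x t - x s) \<in> tangent_space A (y s)"
      "\<And>w. U (y s) (y t) (y' t w) - y' s w \<in> tangent_space A (y s)"
      "linear (\<lambda>w. U (y s) (y t) (y' t w) c)"
    if st: "0 \<le> s" "s \<le> t" "t \<le> T" "\<bar>s - t0\<bar> < e" "\<bar>t - t0\<bar> < e" for s t
  proof -
    show s: "s \<in> {0..T}" "t \<in> {0..T}" using st by auto
    show yN: "y s \<in> N" "y t \<in> N" using e s st by auto
    have "norm (y' s (x t - x s) c) \<le> B * norm (x t - x s)"
      using e s st by auto
    also have "\<dots> \<le> B * \<omega> s t powr (1 / p)"
      using x st e(2) by (intro mult_left_mono) auto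
    finally show "norm (y' s (x t - x s) c) \<le> B * \<omega> s t powr (1 / p)" .
    show "\<omega> s t powr (1 / p) \<le> H"
      unfolding H_def using control_powr_mono[OF \<omega>(1), of 0 s t T "1 / p"] \<omega>(2) st by auto
    show "norm (y' t w c) \<le> B * norm w" for w using e s st by auto
    have D: "(y s, y t) \<in> D" using ND yN by blast
    then have "\<psi> (y s) (y t) \<in> tangent_space A (y s)"
      using A(2) by (auto simp: is_gauge_def is_logarithm_def)
    then show "\<psi> (y s) (y t) - y' s (x t - x s) \<in> tangent_space A (y s)"
      using tangent_space_diff[OF A(1)] tangent s by blast
    have U: "U (y s) (y t) \<in> tangent_linear_maps A (y t) (y s)"
      using A(2) D by (auto simp: is_gauge_def is_parallelism_def)
    then show "U (y s) (y t) (y' t w) - y' s w \<in> tangent_space A (y s)" for w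
      using tangent_space_diff[OF A(1)] tangent s unfolding tangent_linear_maps_def by blast
    have "linear (y' t)" using y(2) s by (auto simp: linear_maps_into_def)
    then show "linear (\<lambda>w. U (y s) (y t) (y' t w) c)"
      using U tangent[OF s(2)] by (auto simp: linear_iff tangent_linear_maps_def scaleR_fun_def)
  qed
  \<comment> \<open>The error made by transporting \<open>y' t w\<close> back to \<open>y s\<close>:
    distance from the identity times the size of \<open>y'\<close>.\<close>
  have par': "norm (U (y s) (y t) (y' t w) c - y' t w c) \<le> K * E * B * \<omega> s t powr (1 / p) * norm w"
    if st: "0 \<le> s" "s \<le> t" "t \<le> T" "\<bar>s - t0\<bar> < e" "\<bar>t - t0\<bar> < e"
      and a: "norm (cmap c (y t) - cmap c (y s)) \<le> E * \<omega> s t powr (1 / p)" and "0 \<le> E" for s t E w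
  proof -
    have "norm (U (y s) (y t) (y' t w) c - y' t w c)
        \<le> K * norm (cmap c (y t) - cmap c (y s)) * norm (y' t w c)"
      using par facts(1,2,4)[OF st] tangent by blast
    also have "\<dots> \<le> K * (E * \<omega> s t powr (1 / p)) * (B * norm w)"
      using K a facts(7)[OF st] \<open>0 \<le> E\<close> by (intro mult_mono mult_nonneg_nonneg) (auto intro: order_trans[OF norm_ge_zero])
    finally show ?thesis by (simp add: mult_ac)
  qed
  have "\<exists>C'\<ge>0. \<forall>s t. 0 \<le> s \<and> s \<le> t \<and> t \<le> T \<and> \<bar>s - t0\<bar> < e \<and> \<bar>t - t0\<bar> < e \<longrightarrow>
       chart_estimate c p \<omega> x y y' C s t \<longrightarrow> gauge_estimate \<psi> U g p \<omega> x y y' C' s t"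
    if C: "0 \<le> C" for C
  proof -
    define E where "E = 2 * (B + C * H)"
    have E: "0 \<le> E" using e C by (simp add: E_def H_def)
    \<comment> \<open>The term with \<open>E\<^sup>2\<close> is the error of the logarithm, the one
      with \<open>E * B\<close> the error of the parallelism; the outer \<open>K\<close> converts
      the norm of the model space into the Riemannian one.\<close>
    define C' where "C' = K * (C + K * E\<^sup>2 + K * E * B)"
    have C': "0 \<le> C'" using C K E e by (simp add: C'_def)
    have "gauge_estimate \<psi> U g p \<omega> x y y' C' s t"
      if st: "0 \<le> s" "s \<le> t" "t \<le> T" "\<bar>s - t0\<bar> < e" "\<bar>t - t0\<bar> < e"
        and est: "chart_estimate c p \<omega> x y y' C s t" for s t
    proof -
      define h where "h = \<omega> s t powr (1 / p)"
      have h: "0 \<le> h" "h \<le> H" by (auto simp: h_def facts(6)[OF st])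
      note f = facts[OF st, folded h_def]
      have est1: "norm (cmap c (y t) - cmap c (y s) - y' s (x t - x s) c) \<le> C * h\<^sup>2"
        and est2: "onorm (\<lambda>w. y' t w c - y' s w c) \<le> C * h"
        using est by (simp_all add: chart_estimate_def h_def powr_two_div)
      note inc = increment_estimates[OF log[OF f(1,2)] small[OF f(1,2)] K f(5) h e(2) C disjI1[OF est1], folded E_def]
      have "metric_norm g (y s) (\<psi> (y s) (y t) - y' s (x t - x s)) \<le> K * ((C + K * E\<^sup>2) * h\<^sup>2)"
        using met2[OF f(1,8)] inc(2) K by (smt (verit) fun_diff_def mult_left_mono)
      also have "\<dots> \<le> C' * h\<^sup>2"
        using K E e by (simp add: C'_def algebra_simps)
      finally have 1: "metric_norm g (y s) (\<psi> (y s) (y t) - y' s (x t - x s)) \<le> C' * h\<^sup>2" .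
      \<comment> \<open>Split into the transport error of \<open>y' t w\<close> and the chart
        increment of \<open>y'\<close>.\<close>
      have "norm ((U (y s) (y t) (y' t w) - y' s w) c) \<le> ((C + K * E * B) * h) * norm w" for w
      proof -
        have "bounded_linear (\<lambda>w. y' t w c - y' s w c)"
          using y'_lin f(3,4) linear_compose_sub linear_conv_bounded_linear by blast
        then have "norm (y' t w c - y' s w c) \<le> onorm (\<lambda>w. y' t w c - y' s w c) * norm w"
          by (rule onorm)
        also have "\<dots> \<le> C * h * norm w"
          using est2 by (intro mult_right_mono) auto
        finally have "norm (y' t w c - y' s w c) \<le> C * h * norm w" .
        moreover have "norm (U (y s) (y t) (y' t w) c - y' t w c) \<le> K * E * B * h * norm w"
          using par'[OF st inc(1)[unfolded h_def] E] by (simp add: h_def)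
        ultimately show ?thesis
          using norm_triangle_ineq[of "U (y s) (y t) (y' t w) c - y' t w c" "y' t w c - y' s w c"]
          by (simp add: algebra_simps)
      qed
      then have "metric_onorm g (y s) (\<lambda>w. U (y s) (y t) (y' t w) - y' s w) \<le> K * ((C + K * E * B) * h)"
        using K C E e h by (intro metric_onorm_le[OF f(9) _ _ met2[OF f(1)]]) auto
      also have "\<dots> \<le> C' * h"
        using K E e h by (simp add: C'_def algebra_simps)
      finally show ?thesis
        using 1 by (simp add: gauge_estimate_def h_def powr_two_div)
    qed
    then show ?thesis using C' by blast
  qed
  moreover have "\<exists>C'\<ge>0. \<forall>s t. 0 \<le> s \<and> s \<le> t \<and> t \<le> T \<and> \<bar>s - t0\<bar> < e \<and> \<bar>t - t0\<bar> < e \<longrightarrow>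
       gauge_estimate \<psi> U g p \<omega> x y y' C s t \<longrightarrow> chart_estimate c p \<omega> x y y' C' s t"
    if C: "0 \<le> C" for C
  proof -
    \<comment> \<open>In coordinates the given gauge bound \<open>C\<close> becomes
      \<open>K * C\<close>, which takes the place of \<open>C\<close> in the increment
      estimate.\<close>
    define E where "E = 2 * (B + K * C * H)"
    have E: "0 \<le> E" using e C K by (simp add: E_def H_def)
    \<comment> \<open>Only the first term needs conversion from the Riemannian norm; the other two
      errors are already measured in the chart.\<close>
    define C' where "C' = K * C + K * E\<^sup>2 + K * E * B"
    have C': "0 \<le> C'" using C K E e by (simp add: C'_def)
    have KC: "0 \<le> K * C" using K C by simp
    have "chart_estimate c p \<omega> x y y' C' s t"
      if st: "0 \<le> s" "s \<le> t" "t \<le> T" "\<bar>s - t0\<bar> < e" "\<bar>t - t0\<bar> < e"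
        and est: "gauge_estimate \<psi> U g p \<omega> x y y' C s t" for s t
    proof -
      define h where "h = \<omega> s t powr (1 / p)"
      have h: "0 \<le> h" "h \<le> H" by (auto simp: h_def facts(6)[OF st])
      note f = facts[OF st, folded h_def]
      have est1: "metric_norm g (y s) (\<psi> (y s) (y t) - y' s (x t - x s)) \<le> C * h\<^sup>2"
        and est2: "metric_onorm g (y s) (\<lambda>w. U (y s) (y t) (y' t w) - y' s w) \<le> C * h"
        using est by (simp_all add: gauge_estimate_def h_def powr_two_div)
      have "norm (\<psi> (y s) (y t) c - y' s (x t - x s) c) \<le> K * metric_norm g (y s) (\<psi> (y s) (y t) - y' s (x t - x s))"
        using met1[OF f(1,8)] by simp
      also have "\<dots> \<le> K * C * h\<^sup>2"
        using est1 K by (simp add: mult.assoc)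
      finally have "norm (\<psi> (y s) (y t) c - y' s (x t - x s) c) \<le> K * C * h\<^sup>2" .
      note inc = increment_estimates[OF log[OF f(1,2)] small[OF f(1,2)] K f(5) h e(2) KC disjI2[OF this], folded E_def]
      have "(K * C + K * E\<^sup>2) * h\<^sup>2 \<le> C' * h\<^sup>2"
        using K E e by (intro mult_right_mono) (auto simp: C'_def)
      then have 1: "norm (cmap c (y t) - cmap c (y s) - y' s (x t - x s) c) \<le> C' * h\<^sup>2"
        using inc(3) by linarith
      have "norm (y' t w c - y' s w c) \<le> C' * h * norm w" for w
      proof -
        have "bounded_linear (\<lambda>w. U (y s) (y t) (y' t w) c - y' s w c)"
          using y'_lin f(3,10) linear_compose_sub linear_conv_bounded_linear by blast
        then have "norm ((U (y s) (y t) (y' t w) - y' s w) c)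
            \<le> K * metric_onorm g (y s) (\<lambda>w. U (y s) (y t) (y' t w) - y' s w) * norm w"
          using K by (intro norm_le_metric_onorm[OF f(9) _ _ met2[OF f(1)] met1[OF f(1)]]) auto
        also have "\<dots> \<le> K * (C * h) * norm w"
          using est2 K by (intro mult_right_mono mult_left_mono) auto
        finally have "norm (U (y s) (y t) (y' t w) c - y' s w c) \<le> K * (C * h) * norm w" by simp
        moreover have "norm (U (y s) (y t) (y' t w) c - y' t w c) \<le> K * E * B * h * norm w"
          using par'[OF st inc(1)[unfolded h_def] E] by (simp add: h_def)
        moreover have "norm (y' t w c - y' s w c)
            \<le> norm (U (y s) (y t) (y' t w) c - y' t w c) + norm (U (y s) (y t) (y' t w) c - y' s w c)"
          using norm_triangle_ineq[of "y' t w c - U (y s) (y t) (y' t w) c" "U (y s) (y t) (y' t w) c - y' s w c"]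
          by (simp add: norm_minus_commute)
        moreover have "0 \<le> K * E\<^sup>2 * h * norm w" using K h by simp
        ultimately show ?thesis
          by (simp add: C'_def algebra_simps)
      qed
      then have "onorm (\<lambda>w. y' t w c - y' s w c) \<le> C' * h"
        using C' h by (intro onorm_bound) auto
      then show ?thesis
        using 1 by (simp add: chart_estimate_def h_def powr_two_div)
    qed
    then show ?thesis using C' by blast
  qed
  moreover have "\<forall>s\<in>{0..T}. \<bar>s - t0\<bar> < e \<longrightarrow> y s \<in> cdom c"
    using e(3) N(3) by blast
  moreover have "\<forall>s\<in>{0..T}. \<forall>t\<in>{0..T}. \<bar>s - t0\<bar> < e \<and> \<bar>t - t0\<bar> < e \<longrightarrow> (y s, y t) \<in> D"
    using e(3) ND by blast
  ultimately show ?thesis using e(1) by blast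
qed

section \<open>Globalisation in time\<close>

text \<open>The remainder over \<open>[s, t]\<close> is the sum of those over \<open>[s, v]\<close>
  and \<open>[v, t]\<close> and of \<open>y' v - y' s\<close> applied to \<open>x t - x v\<close>.
  The last term is a product of two quantities of order \<open>h\<close>, hence of second order.
  Three terms of size \<open>C * h\<^sup>2\<close> explain the factor \<open>3\<close>.\<close>

lemma chart_estimate_trans:
  fixes y' :: "real \<Rightarrow> 'w::euclidean_space \<Rightarrow> ('m, 'e::real_normed_vector) tvec"
  assumes "is_control T \<omega>" "0 < p" "0 \<le> s" "s \<le> v" "v \<le> t" "t \<le> T" "0 \<le> C"
    and x: "norm (x t - x v) \<le> \<omega> v t powr (1 / p)"
    and lin: "linear (\<lambda>w. y' s w c)" "linear (\<lambda>w. y' v w c)" "linear (\<lambda>w. y' t w c)"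
    and est: "chart_estimate c p \<omega> x y y' C s v" "chart_estimate c p \<omega> x y y' C v t"
  shows "chart_estimate c p \<omega> x y y' (3 * C) s t"
proof -
  define h where "h = \<omega> s t powr (1 / p)"
  have "\<omega> s v powr (1 / p) \<le> h" "\<omega> v t powr (1 / p) \<le> h"
    using control_powr_mono[OF assms(1), of s s v t "1 / p"] control_powr_mono[OF assms(1), of s v t t "1 / p"]
      assms(2-6) unfolding h_def by auto
  then have h: "C * \<omega> s v powr (1 / p) \<le> C * h" "C * \<omega> v t powr (1 / p) \<le> C * h"
    "C * \<omega> s v powr (2 / p) \<le> C * h\<^sup>2" "C * \<omega> v t powr (2 / p) \<le> C * h\<^sup>2" "norm (x t - x v) \<le> h"
    using assms(7) x by (auto simp: powr_two_div intro!: mult_left_mono power_mono)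
  have bl: "bounded_linear (\<lambda>w. y' v w c - y' s w c)" "bounded_linear (\<lambda>w. y' t w c - y' v w c)"
    using lin linear_compose_sub linear_conv_bounded_linear by blast+
  have on: "onorm (\<lambda>w. y' v w c - y' s w c) \<le> C * h" "onorm (\<lambda>w. y' t w c - y' v w c) \<le> C * h"
    using est h by (auto simp: chart_estimate_def)
  have "onorm (\<lambda>w. (y' t w c - y' v w c) + (y' v w c - y' s w c)) \<le> C * h + C * h"
    using onorm_triangle[OF bl(2,1)] on by linarith
  \<comment> \<open>Two increments give \<open>2 * C\<close>; nonnegativity of \<open>C * h\<close>
    lets it be raised to the common factor.\<close>
  then have 1: "onorm (\<lambda>w. y' t w c - y' s w c) \<le> 3 * C * h"
    using on(1) onorm_pos_le[OF bl(1)] by simp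
  let ?r = "\<lambda>s t. cmap c (y t) - cmap c (y s) - y' s (x t - x s) c"
  have r: "norm (?r s v) \<le> C * h\<^sup>2" "norm (?r v t) \<le> C * h\<^sup>2"
    using est h by (auto simp: chart_estimate_def)
  have "norm (y' v (x t - x v) c - y' s (x t - x v) c) \<le> onorm (\<lambda>w. y' v w c - y' s w c) * norm (x t - x v)"
    by (rule onorm[OF bl(1)])
  also have "\<dots> \<le> C * h * h"
    using on h assms(7) by (intro mult_mono) (auto simp: h_def)
  finally have m: "norm (y' v (x t - x v) c - y' s (x t - x v) c) \<le> C * h\<^sup>2"
    by (simp add: power2_eq_square)
  have "y' s (x t - x s) c = y' s (x t - x v) c + y' s (x v - x s) c"
    using linear_add[OF lin(1), of "x t - x v" "x v - x s"] by simp
  then have "?r s t = ?r s v + ?r v t + (y' v (x t - x v) c - y' s (x t - x v) c)"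
    by simp
  also have "norm \<dots> \<le> C * h\<^sup>2 + C * h\<^sup>2 + C * h\<^sup>2"
    by (intro norm_triangle_le add_mono r m)
  finally show ?thesis
    using 1 by (simp add: chart_estimate_def h_def powr_two_div)
qed

text \<open>A Lebesgue number argument by bisection: finitely many local constants and radii are
  merged by maximum and minimum.\<close>

lemma uniform_local_estimate:
  fixes P :: "real \<Rightarrow> real \<Rightarrow> real \<Rightarrow> bool"
  assumes "a \<le> b"
    and mono: "\<And>C C' s t. P C s t \<Longrightarrow> C \<le> C' \<Longrightarrow> P C' s t"
    and loc: "\<And>t0. t0 \<in> {a..b} \<Longrightarrow> \<exists>e>0. \<exists>C. \<forall>s t. a \<le> s \<longrightarrow> s \<le> t \<longrightarrow> t \<le> b \<longrightarrow> \<bar>s - t0\<bar> < e \<longrightarrow> \<bar>t - t0\<bar> < e \<longrightarrow> P C s t"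
  shows "\<exists>C>0. \<exists>\<delta>>0. \<forall>s t. a \<le> s \<and> s \<le> t \<and> t \<le> b \<and> t - s \<le> \<delta> \<longrightarrow> P C s t"
proof -
  \<comment> \<open>Only \<open>s\<close> is confined to \<open>[u, v]\<close>; \<open>t\<close> may
    run past \<open>v\<close>. Pairs that straddle a cut are thus already covered, and gluing needs
    just a case distinction on \<open>s\<close>.\<close>
  define R where "R u v \<delta> C \<longleftrightarrow>
    (\<forall>s t. a \<le> s \<and> u \<le> s \<and> s \<le> v \<and> s \<le> t \<and> t - s \<le> \<delta> \<and> t \<le> b \<longrightarrow> P C s t)" for u v \<delta> C
  from assms(1) have "\<exists>\<delta>>0. \<exists>C>0. R a b \<delta> C"
  proof (induction rule: Bolzano[where P = "\<lambda>u v. \<exists>\<delta>>0. \<exists>C>0. R u v \<delta> C"])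
    case (trans u v w)
    obtain \<delta> C where 1: "\<delta> > 0" "C > 0" "R u v \<delta> C"
      using trans(1) by blast
    obtain \<delta>' C' where 2: "\<delta>' > 0" "C' > 0" "R v w \<delta>' C'"
      using trans(2) by blast
    have "P (max C C') s t"
      if "a \<le> s \<and> u \<le> s \<and> s \<le> w \<and> s \<le> t \<and> t - s \<le> min \<delta> \<delta>' \<and> t \<le> b" for s t
    proof (cases "s \<le> v")
      case True
      then show ?thesis using 1(3) that unfolding R_def by (intro mono[of C s t "max C C'"]) auto
    next
      case False
      then show ?thesis using 2(3) that unfolding R_def by (intro mono[of C' s t "max C C'"]) auto
    qed
    then have "R u w (min \<delta> \<delta>') (max C C')" by (simp add: R_def)
    moreover have "min \<delta> \<delta>' > 0" "max C C' > 0" using 1 2 by auto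
    ultimately show ?case by blast
  next
    case (local r)
    obtain e C where e: "e > 0"
      "\<forall>s t. a \<le> s \<longrightarrow> s \<le> t \<longrightarrow> t \<le> b \<longrightarrow> \<bar>s - r\<bar> < e \<longrightarrow> \<bar>t - r\<bar> < e \<longrightarrow> P C s t"
      using loc[of r] local by auto
    \<comment> \<open>Then \<open>s\<close> is within \<open>e / 2\<close> of \<open>r\<close>, and
      \<open>t\<close> within \<open>e / 2 + e / 4\<close>. The maximum with \<open>1\<close> makes
      the constant positive.\<close>
    have "R u v (e / 4) (max C 1)" if uv: "u \<le> r" "r \<le> v" "v - u < e / 2" for u v
      unfolding R_def
    proof (intro allI impI)
      fix s t assume st: "a \<le> s \<and> u \<le> s \<and> s \<le> v \<and> s \<le> t \<and> t - s \<le> e / 4 \<and> t \<le> b"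
      then have "\<bar>s - r\<bar> < e" "\<bar>t - r\<bar> < e" using uv e(1) by (auto simp: abs_less_iff)
      then have "P C s t" using e(2) st by blast
      then show "P (max C 1) s t" by (rule mono) simp
    qed
    moreover have "e / 4 > 0" "max C 1 > 0" using e(1) by auto
    ultimately have "\<forall>u v. u \<le> r \<and> r \<le> v \<and> v - u < e / 2 \<longrightarrow> (\<exists>\<delta>>0. \<exists>C>0. R u v \<delta> C)" by blast
    then show ?case using e(1) by (intro exI[of _ "e / 2"]) simp
  qed
  then obtain \<delta> C where "\<delta> > 0" "C > 0" "R a b \<delta> C" by blast
  then show ?thesis
    unfolding R_def by (intro exI[of _ C] exI[of _ \<delta>]) auto
qed

text \<open>Here no closeness of \<open>s\<close> and \<open>t\<close> is available, so pairs across
  a cut must be composed. The constant triples at each gluing, which is harmless since bisection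
  asks only that some constant exists.\<close>

lemma chart_estimate_from_local:
  fixes y' :: "real \<Rightarrow> 'w::euclidean_space \<Rightarrow> ('m, 'e::real_normed_vector) tvec"
  assumes \<omega>: "is_control T \<omega>" "0 < p"
    and ab: "0 \<le> a" "a \<le> b" "b \<le> T"
    and x: "\<forall>s t. 0 \<le> s \<and> s \<le> t \<and> t \<le> T \<longrightarrow> norm (x t - x s) \<le> \<omega> s t powr (1 / p)"
    and lin: "\<And>s. s \<in> {a..b} \<Longrightarrow> linear (\<lambda>w. y' s w c)"
    and loc: "\<And>t0. t0 \<in> {a..b} \<Longrightarrow> \<exists>e>0. \<exists>C. \<forall>s t. a \<le> s \<longrightarrow> s \<le> t \<longrightarrow> t \<le> b \<longrightarrow> \<bar>s - t0\<bar> < e \<longrightarrow> \<bar>t - t0\<bar> < e \<longrightarrow>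
      chart_estimate c p \<omega> x y y' C s t"
  shows "\<exists>C\<ge>0. \<forall>s t. a \<le> s \<and> s \<le> t \<and> t \<le> b \<longrightarrow> chart_estimate c p \<omega> x y y' C s t"
proof -
  let ?P = "chart_estimate c p \<omega> x y y'"
  \<comment> \<open>The bisection predicate clips \<open>[u, v]\<close> to \<open>[a, b]\<close>,
    because the small intervals of its local step may stick out; at \<open>u = a\<close> and
    \<open>v = b\<close> the conditions repeat.\<close>
  have "\<exists>C\<ge>0. \<forall>s t. a \<le> s \<and> a \<le> s \<and> s \<le> t \<and> t \<le> b \<and> t \<le> b \<longrightarrow> ?P C s t"
    using ab(2)
  proof (induction rule: Bolzano[where P = "\<lambda>u v. \<exists>C\<ge>0. \<forall>s t. a \<le> s \<and> u \<le> s \<and> s \<le> t \<and> t \<le> v \<and> t \<le> b \<longrightarrow> ?P C s t"])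
    case (trans u v w)
    obtain C where 1: "C \<ge> 0" "\<And>s t. a \<le> s \<and> u \<le> s \<and> s \<le> t \<and> t \<le> v \<and> t \<le> b \<Longrightarrow> ?P C s t"
      using trans(1) by blast
    obtain C' where 2: "C' \<ge> 0" "\<And>s t. a \<le> s \<and> v \<le> s \<and> s \<le> t \<and> t \<le> w \<and> t \<le> b \<Longrightarrow> ?P C' s t"
      using trans(2) by blast
    have "?P (3 * max C C') s t" if st: "a \<le> s \<and> u \<le> s \<and> s \<le> t \<and> t \<le> w \<and> t \<le> b" for s t
    proof -
      consider "t \<le> v" | "v \<le> s" | "s \<le> v" "v \<le> t" by linarith
      then show ?thesis
      proof cases
        assume "t \<le> v"
        then show ?thesis
          using 1(2)[of s t] 1(1) 2(1) st by (intro chart_estimate_mono[of c p \<omega> x y y' C s t "3 * max C C'"]) auto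
      next
        assume "v \<le> s"
        then show ?thesis
          using 2(2)[of s t] 1(1) 2(1) st by (intro chart_estimate_mono[of c p \<omega> x y y' C' s t "3 * max C C'"]) auto
      next
        assume v: "s \<le> v" "v \<le> t"
        have "?P (max C C') s v" "?P (max C C') v t"
          using 1(2)[of s v] 2(2)[of v t] v st chart_estimate_mono[of c p \<omega> x y y' C s v]
            chart_estimate_mono[of c p \<omega> x y y' C' v t] by auto
        then show ?thesis
          using v st ab 1(1) x by (intro chart_estimate_trans[OF \<omega>, where v = v] lin) auto
      qed
    qed
    moreover have "3 * max C C' \<ge> 0" using 1 by simp
    ultimately show ?case by blast
  next
    case (local r)
    obtain e C where e: "e > 0"
      "\<And>s t. a \<le> s \<Longrightarrow> s \<le> t \<Longrightarrow> t \<le> b \<Longrightarrow> \<bar>s - r\<bar> < e \<Longrightarrow> \<bar>t - r\<bar> < e \<Longrightarrow> ?P C s t"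
      using loc[of r] local by auto
    have "?P (max C 0) s t"
      if "u \<le> r \<and> r \<le> v \<and> v - u < e" "a \<le> s \<and> u \<le> s \<and> s \<le> t \<and> t \<le> v \<and> t \<le> b" for u v s t
    proof -
      have "\<bar>s - r\<bar> < e" "\<bar>t - r\<bar> < e" using that by (auto simp: abs_less_iff)
      then show ?thesis
        using e(2)[of s t] that by (intro chart_estimate_mono[of c p \<omega> x y y' C s t "max C 0"]) auto
    qed
    then have "\<forall>u v. u \<le> r \<and> r \<le> v \<and> v - u < e \<longrightarrow>
        (\<exists>C\<ge>0. \<forall>s t. a \<le> s \<and> u \<le> s \<and> s \<le> t \<and> t \<le> v \<and> t \<le> b \<longrightarrow> ?P C s t)"
      by (meson max.cobounded2)
    then show ?case using e(1) by blast
  qed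
  then show ?thesis by simp
qed

theorem theorem2p44:
  fixes A :: "('m::{t2_space, second_countable_topology}, 'e::fin_dim_inner) chart set"
    and D :: "('m \<times> 'm) set"
    and \<psi> :: "'m \<Rightarrow> 'm \<Rightarrow> ('m, 'e) tvec"
    and U :: "'m \<Rightarrow> 'm \<Rightarrow> ('m, 'e) tvec \<Rightarrow> ('m, 'e) tvec"
    and g :: "'m \<Rightarrow> ('m, 'e) tvec \<Rightarrow> ('m, 'e) tvec \<Rightarrow> real"
    and T p :: real
    and \<omega> :: "real \<Rightarrow> real \<Rightarrow> real"
    and x :: "real \<Rightarrow> real^'k"
    and XX :: "real \<Rightarrow> real \<Rightarrow> real^'k^'k"
    and y :: "real \<Rightarrow> 'm"
    and y' :: "real \<Rightarrow> real^'k \<Rightarrow> ('m, 'e) tvec"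
  assumes "0 < T" and "1 \<le> p" and "p < 3"
    and "weak_geometric_rough_path T p \<omega> x XX"
    and "smooth_structure A"
    and "is_gauge A D \<psi> U"
    and "riemannian_metric A g"
    and "continuous_on {0..T} y"
    and "\<forall>s\<in>{0..T}. y' s \<in> linear_maps_into A (y s)"
    and "continuous_map_into (linear_maps_atlas A) {0..T} (\<lambda>s. (y s, y' s))"
  shows "chart_rough_path A T p \<omega> x y y' \<longleftrightarrow> gauge_rough_path D \<psi> U g T p \<omega> x y y'"
proof -
  have p: "0 < p" using assms(2) by simp
  have \<omega>: "is_control T \<omega>" using assms(4) by (simp add: weak_geometric_rough_path_def)
  have x: "\<forall>s t. 0 \<le> s \<and> s \<le> t \<and> t \<le> T \<longrightarrow> norm (x t - x s) \<le> \<omega> s t powr (1 / p)"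
    using assms(4) by (auto simp: weak_geometric_rough_path_def simplex2_def)
  have chart: "chart_rough_path A T p \<omega> x y y' \<longleftrightarrow>
      (\<forall>c\<in>A. \<forall>a b. 0 \<le> a \<and> a \<le> b \<and> b \<le> T \<and> y ` {a..b} \<subseteq> cdom c \<longrightarrow>
        (\<exists>C\<ge>0. \<forall>s t. a \<le> s \<and> s \<le> t \<and> t \<le> b \<longrightarrow> chart_estimate c p \<omega> x y y' C s t))"
    by (simp add: chart_rough_path_def chart_estimate_def chart_differential_def)
  have gauge: "gauge_rough_path D \<psi> U g T p \<omega> x y y' \<longleftrightarrow>
      (\<exists>C>0. \<exists>\<delta>>0. \<forall>s t. 0 \<le> s \<and> s \<le> t \<and> t \<le> T \<and> t - s \<le> \<delta> \<longrightarrow>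
        (y s, y t) \<in> D \<and> gauge_estimate \<psi> U g p \<omega> x y y' C s t)"
    by (simp add: gauge_rough_path_def gauge_estimate_def)
  show ?thesis
  proof
    assume L: "chart_rough_path A T p \<omega> x y y'"
    have loc: "\<exists>e>0. \<exists>C. \<forall>s t. 0 \<le> s \<longrightarrow> s \<le> t \<longrightarrow> t \<le> T \<longrightarrow> \<bar>s - t0\<bar> < e \<longrightarrow> \<bar>t - t0\<bar> < e \<longrightarrow>
        (y s, y t) \<in> D \<and> gauge_estimate \<psi> U g p \<omega> x y y' C s t" if t0: "t0 \<in> {0..T}" for t0
    proof -
      obtain c where c: "c \<in> A" "y t0 \<in> cdom c"
        using assms(5) unfolding smooth_structure_def by blast
      obtain e where e: "e > 0"
        "\<forall>s\<in>{0..T}. \<bar>s - t0\<bar> < e \<longrightarrow> y s \<in> cdom c"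
        "\<forall>s\<in>{0..T}. \<forall>t\<in>{0..T}. \<bar>s - t0\<bar> < e \<and> \<bar>t - t0\<bar> < e \<longrightarrow> (y s, y t) \<in> D"
        "\<forall>C\<ge>0. \<exists>C'\<ge>0. \<forall>s t. 0 \<le> s \<and> s \<le> t \<and> t \<le> T \<and> \<bar>s - t0\<bar> < e \<and> \<bar>t - t0\<bar> < e \<longrightarrow>
       chart_estimate c p \<omega> x y y' C s t \<longrightarrow> gauge_estimate \<psi> U g p \<omega> x y y' C' s t"
        using local_estimates_equivalent[OF assms(5-10) \<omega> p x c(1) t0 c(2)] by (elim exE conjE)
      \<comment> \<open>The chart condition speaks of closed intervals mapped into the chart domain;
        half the radius, clipped to \<open>[0, T]\<close>, provides one.\<close>
      define a b where "a = max 0 (t0 - e / 2)" and "b = min T (t0 + e / 2)"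
      have ab: "0 \<le> a" "a \<le> b" "b \<le> T" using t0 e(1) by (auto simp: a_def b_def)
      have "y ` {a..b} \<subseteq> cdom c"
      proof safe
        fix s assume "s \<in> {a..b}"
        then have "s \<in> {0..T}" "\<bar>s - t0\<bar> < e"
          using e(1) by (auto simp: a_def b_def abs_less_iff)
        then show "y s \<in> cdom c" using e(2) by blast
      qed
      then obtain C where C: "C \<ge> 0" "\<And>s t. a \<le> s \<and> s \<le> t \<and> t \<le> b \<Longrightarrow> chart_estimate c p \<omega> x y y' C s t"
        using L c(1) ab unfolding chart by metis
      obtain C' where C': "\<And>s t. 0 \<le> s \<Longrightarrow> s \<le> t \<Longrightarrow> t \<le> T \<Longrightarrow> \<bar>s - t0\<bar> < e \<Longrightarrow> \<bar>t - t0\<bar> < e \<Longrightarrow>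
           chart_estimate c p \<omega> x y y' C s t \<Longrightarrow> gauge_estimate \<psi> U g p \<omega> x y y' C' s t"
        using e(4) C(1) by blast
      have "(y s, y t) \<in> D \<and> gauge_estimate \<psi> U g p \<omega> x y y' C' s t"
        if st: "0 \<le> s" "s \<le> t" "t \<le> T" "\<bar>s - t0\<bar> < e / 2" "\<bar>t - t0\<bar> < e / 2" for s t
      proof -
        have "a \<le> s" "t \<le> b"
          using st by (auto simp: a_def b_def abs_if split: if_splits)
        moreover have "\<bar>s - t0\<bar> < e" "\<bar>t - t0\<bar> < e"
          using st(4,5) e(1) by linarith+
        moreover have "s \<in> {0..T}" "t \<in> {0..T}"
          using st by auto
        ultimately show ?thesis
          using C'[of s t] C(2)[of s t] e(3) st(1-3) by blast
      qed
      then show ?thesis using e(1) by (intro exI[of _ "e / 2"]) auto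
    qed
    show "gauge_rough_path D \<psi> U g T p \<omega> x y y'"
      unfolding gauge
      \<comment> \<open>The predicate made uniform is the conjunction of domain membership and gauge
        estimate, so a single \<open>\<delta>\<close> serves both.\<close>
      by (rule uniform_local_estimate) (use assms(1) gauge_estimate_mono loc in auto)
  next
    assume "gauge_rough_path D \<psi> U g T p \<omega> x y y'"
    then obtain C \<delta> where C: "C > 0" "\<delta> > 0"
      "\<And>s t. 0 \<le> s \<and> s \<le> t \<and> t \<le> T \<and> t - s \<le> \<delta> \<Longrightarrow> gauge_estimate \<psi> U g p \<omega> x y y' C s t"
      unfolding gauge by blast
    show "chart_rough_path A T p \<omega> x y y'"
      unfolding chart
    proof (intro ballI allI impI)
      fix c a b assume c: "c \<in> A" and "0 \<le> a \<and> a \<le> b \<and> b \<le> T \<and> y ` {a..b} \<subseteq> cdom c"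
      then have ab: "0 \<le> a" "a \<le> b" "b \<le> T" "y ` {a..b} \<subseteq> cdom c" by auto
      show "\<exists>C\<ge>0. \<forall>s t. a \<le> s \<and> s \<le> t \<and> t \<le> b \<longrightarrow> chart_estimate c p \<omega> x y y' C s t"
      proof (rule chart_estimate_from_local[OF \<omega> p ab(1-3) x])
        show "linear (\<lambda>w. y' s w c)" if "s \<in> {a..b}" for s
          using linear_in_chart[of "y' s" A "y s" c] assms(9) that ab by auto
        fix t0 assume "t0 \<in> {a..b}"
        then have t0: "t0 \<in> {0..T}" "y t0 \<in> cdom c" using ab by auto
        obtain e where e: "e > 0"
          "\<forall>C\<ge>0. \<exists>C'\<ge>0. \<forall>s t. 0 \<le> s \<and> s \<le> t \<and> t \<le> T \<and> \<bar>s - t0\<bar> < e \<and> \<bar>t - t0\<bar> < e \<longrightarrow>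
       gauge_estimate \<psi> U g p \<omega> x y y' C s t \<longrightarrow> chart_estimate c p \<omega> x y y' C' s t"
          using local_estimates_equivalent[OF assms(5-10) \<omega> p x c t0] by (elim exE conjE)
        obtain C' where C': "\<And>s t. 0 \<le> s \<Longrightarrow> s \<le> t \<Longrightarrow> t \<le> T \<Longrightarrow> \<bar>s - t0\<bar> < e \<Longrightarrow> \<bar>t - t0\<bar> < e \<Longrightarrow>
             gauge_estimate \<psi> U g p \<omega> x y y' C s t \<Longrightarrow> chart_estimate c p \<omega> x y y' C' s t"
          using e(2) C(1) by (meson less_imp_le)
        have "chart_estimate c p \<omega> x y y' C' s t"
          \<comment> \<open>Two times within \<open>\<delta> / 2\<close> of \<open>t0\<close> differ
            by less than \<open>\<delta>\<close>, so the gauge estimate is available for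
            them.\<close>
          if st: "a \<le> s" "s \<le> t" "t \<le> b" "\<bar>s - t0\<bar> < min e (\<delta> / 2)" "\<bar>t - t0\<bar> < min e (\<delta> / 2)" for s t
        proof -
          have "0 \<le> s \<and> s \<le> t \<and> t \<le> T \<and> t - s \<le> \<delta>"
            using st ab by linarith
          then show ?thesis using C' C(3)[of s t] st by auto
        qed
        then show "\<exists>e>0. \<exists>C. \<forall>s t. a \<le> s \<longrightarrow> s \<le> t \<longrightarrow> t \<le> b \<longrightarrow> \<bar>s - t0\<bar> < e \<longrightarrow> \<bar>t - t0\<bar> < e \<longrightarrow>
            chart_estimate c p \<omega> x y y' C s t"
          using e(1) C(2) by (intro exI[of _ "min e (\<delta> / 2)"], intro conjI exI[of _ C']) auto
      qed
    qed
  qed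
qed

end
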